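(* The gauged system $G'=(\mathrm{PFO},\to_{\{S\downarrow,M\}},\mathsf{width})/\stackrel{*}{\leftrightarrow}_{\mathcal{T}}$ is monotone; that is, whenever $C_1,C_2$ are $\stackrel{*}{\leftrightarrow}_{\mathcal{T}}$-equivalence classes of pfo-formulas and there exist $\theta_1\in C_1$, $\theta_2\in C_2$ with $\theta_1\to_{\{S\downarrow,M\}}\theta_2$, we have $\inf\{\mathsf{width}(\theta):\theta\in C_1\}\ge\inf\{\mathsf{width}(\theta):\theta\in C_2\}$.
   Context: All formulas are relational first-order formulas; $\wedge,\vee$ are binary. A pfo-formula is a first-order formula with no negation; $\mathrm{PFO}$ is the class of all pfo-formulas; $\mathrm{free}(\psi)$ is the set of free variables of $\psi$. The width $\mathsf{width}(\phi)$ of a formula is the maximum of $|\mathrm{free}(\psi)|$ over all subformulas $\psi$ of $\phi$. Rewriting rules (applicable to any subformula occurrence; $\oplus\in\{\wedge,\vee\}$, $Q\in\{\exists,\forall\}$): $A$: $F_1\oplus(F_2\oplus F_3)\to(F_1\oplus F_2)\oplus F_3$ and its converse; $C$: $F_1\oplus F_2\to F_2\oplus F_1$; $O$: $QxQyF\to QyQxF$; $P\!\downarrow$: $\exists x(F_1\wedge F_2)\to(\exists xF_1)\wedge F_2$ and $\forall x(F_1\vee F_2)\to(\forall xF_1)\vee F_2$ whenever $x\notin\mathrm{free}(F_2)$; $P\!\uparrow$: inverse of $P\!\downarrow$; $N$: $QxF\to QyF'$ when $y\notin\mathrm{free}(F)$ and $F'$ arises from $F$ by replacing each free occurrence of $x$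 by $y$; $S\!\downarrow$: $\exists x(F_1\vee F_2)\to(\exists xF_1)\vee(\exists xF_2)$ and $\forall x(F_1\wedge F_2)\to(\forall xF_1)\wedge(\forall xF_2)$; $M$: $QxF\to F$ when $x\notin\mathrm{free}(F)$. $\mathcal{T}=\{A,C,O,P\!\downarrow,P\!\uparrow,N\}$. For a set $\mathcal{R}$ of rules, $\to_{\mathcal{R}}$ is the union of the $\to_R$; $\stackrel{*}{\leftrightarrow}_{\mathcal{R}}$ is the reflexive-transitive closure of $\to_{\mathcal{R}}$ together with its inverse. A gauged system is a triple $(D,\to,g)$ with $\to$ a binary relation on $D$ and $g:D\to\mathbb{R}$; it is monotone if $d\to e$ implies $g(d)\ge g(e)$. For an equivalence relation $\equiv$ on $D$, $(D,\to,g)/\equiv$ is the gauged system whose elements are the $\equiv$-classes, with $C\to C'$ iff some $d\in C$, $d'\in C'$ satisfy $d\to d'$, and with gauge $g(C)=\inf\{g(d):d\in C\}$.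
   Formalization: Rule N is applied only when replacing the free occurrences of x in F by y causes no variable capture (no such occurrence lies in the scope of a quantifier on y); with capture allowed the claim fails, e.g. from ∃x∃y(A(x,a)∧B(y,b)). *)

theory Defs
  imports Complex_Main
begin

type_synonym var = nat

datatype conn = And | Or

datatype quant = Ex | All

text \<open>A relational signature is given by an arity function on the type \<open>'r\<close> of relation
  symbols; the arity condition on atoms is imposed by \<open>wf_fo\<close> below.\<close>

datatype 'r fo =
    Atom 'r "var list"
  | Neg "'r fo"
  | Bin conn "'r fo" "'r fo"
  | Quant quant var "'r fo"

fun wf_fo :: "('r \<Rightarrow> nat) \<Rightarrow> 'r fo \<Rightarrow> bool" where
  "wf_fo ar (Atom r xs) \<longleftrightarrow> length xs = ar r"
| "wf_fo ar (Neg F) \<longleftrightarrow> wf_fo ar F"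
| "wf_fo ar (Bin c F G) \<longleftrightarrow> wf_fo ar F \<and> wf_fo ar G"
| "wf_fo ar (Quant q x F) \<longleftrightarrow> wf_fo ar F"

fun subformulas :: "'r fo \<Rightarrow> 'r fo set" where
  "subformulas (Atom r xs) = {Atom r xs}"
| "subformulas (Neg F) = insert (Neg F) (subformulas F)"
| "subformulas (Bin c F G) = insert (Bin c F G) (subformulas F \<union> subformulas G)"
| "subformulas (Quant q x F) = insert (Quant q x F) (subformulas F)"

fun free :: "'r fo \<Rightarrow> var set" where
  "free (Atom r xs) = set xs"
| "free (Neg F) = free F"
| "free (Bin c F G) = free F \<union> free G"
| "free (Quant q x F) = free F - {x}"

definition width :: "'r fo \<Rightarrow> nat" where
  "width \<phi> = Max ((\<lambda>\<psi>. card (free \<psi>)) ` subformulas \<phi>)"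

definition PFO :: "('r \<Rightarrow> nat) \<Rightarrow> 'r fo set" where
  "PFO ar = {\<phi>. wf_fo ar \<phi> \<and> (\<forall>F. Neg F \<notin> subformulas \<phi>)}"

text \<open>\<open>rename x y F\<close> replaces each free occurrence of \<open>x\<close> in \<open>F\<close> by \<open>y\<close>.\<close>

fun rename :: "var \<Rightarrow> var \<Rightarrow> 'r fo \<Rightarrow> 'r fo" where
  "rename x y (Atom r zs) = Atom r (map (\<lambda>z. if z = x then y else z) zs)"
| "rename x y (Neg F) = Neg (rename x y F)"
| "rename x y (Bin c F G) = Bin c (rename x y F) (rename x y G)"
| "rename x y (Quant q z F) = (if z = x then Quant q z F else Quant q z (rename x y F))"

text \<open>\<open>substitutable x y F\<close>: no free occurrence of \<open>x\<close> in \<open>F\<close> lies in the scope of a quantifier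
  binding \<open>y\<close>, so that \<open>rename x y F\<close> captures nothing. Rule \<open>N\<close> needs this convention, since
  otherwise it would rewrite \<open>\<exists>x. \<exists>y. R(x,y)\<close> to \<open>\<exists>y. \<exists>y. R(y,y)\<close>.\<close>

fun substitutable :: "var \<Rightarrow> var \<Rightarrow> 'r fo \<Rightarrow> bool" where
  "substitutable x y (Atom r zs) \<longleftrightarrow> True"
| "substitutable x y (Neg F) \<longleftrightarrow> substitutable x y F"
| "substitutable x y (Bin c F G) \<longleftrightarrow> substitutable x y F \<and> substitutable x y G"
| "substitutable x y (Quant q z F) \<longleftrightarrow>
     (x \<in> free (Quant q z F) \<longrightarrow> z \<noteq> y \<and> substitutable x y F)"

datatype rule = Rule_A | Rule_C | Rule_O | Rule_Pdown | Rule_Pup | Rule_N | Rule_Sdown | Rule_M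

inductive rewr_root :: "rule \<Rightarrow> 'r fo \<Rightarrow> 'r fo \<Rightarrow> bool" where
  assoc_left: "rewr_root Rule_A (Bin c F1 (Bin c F2 F3)) (Bin c (Bin c F1 F2) F3)"
| assoc_right: "rewr_root Rule_A (Bin c (Bin c F1 F2) F3) (Bin c F1 (Bin c F2 F3))"
| comm: "rewr_root Rule_C (Bin c F1 F2) (Bin c F2 F1)"
| reorder: "rewr_root Rule_O (Quant q x (Quant q y F)) (Quant q y (Quant q x F))"
| push_Ex: "x \<notin> free F2 \<Longrightarrow>
    rewr_root Rule_Pdown (Quant Ex x (Bin And F1 F2)) (Bin And (Quant Ex x F1) F2)"
| push_All: "x \<notin> free F2 \<Longrightarrow>
    rewr_root Rule_Pdown (Quant All x (Bin Or F1 F2)) (Bin Or (Quant All x F1) F2)"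
| pull: "rewr_root Rule_Pdown F G \<Longrightarrow> rewr_root Rule_Pup G F"
| rename: "y \<notin> free F \<Longrightarrow> substitutable x y F \<Longrightarrow>
    rewr_root Rule_N (Quant q x F) (Quant q y (rename x y F))"
| split_Ex: "rewr_root Rule_Sdown
    (Quant Ex x (Bin Or F1 F2)) (Bin Or (Quant Ex x F1) (Quant Ex x F2))"
| split_All: "rewr_root Rule_Sdown
    (Quant All x (Bin And F1 F2)) (Bin And (Quant All x F1) (Quant All x F2))"
| remove: "x \<notin> free F \<Longrightarrow> rewr_root Rule_M (Quant q x F) F"

inductive rewr :: "rule set \<Rightarrow> 'r fo \<Rightarrow> 'r fo \<Rightarrow> bool" for Rs where
  root: "R \<in> Rs \<Longrightarrow> rewr_root R F G \<Longrightarrow> rewr Rs F G"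
| neg: "rewr Rs F G \<Longrightarrow> rewr Rs (Neg F) (Neg G)"
| left: "rewr Rs F G \<Longrightarrow> rewr Rs (Bin c F H) (Bin c G H)"
| right: "rewr Rs F G \<Longrightarrow> rewr Rs (Bin c H F) (Bin c H G)"
| quant: "rewr Rs F G \<Longrightarrow> rewr Rs (Quant q x F) (Quant q x G)"

definition T_rules :: "rule set" where
  "T_rules = {Rule_A, Rule_C, Rule_O, Rule_Pdown, Rule_Pup, Rule_N}"

definition PFO_rewr :: "('r \<Rightarrow> nat) \<Rightarrow> rule set \<Rightarrow> 'r fo rel" where
  "PFO_rewr ar Rs = {(\<phi>, \<psi>). \<phi> \<in> PFO ar \<and> \<psi> \<in> PFO ar \<and> rewr Rs \<phi> \<psi>}"

definition PFO_equiv :: "('r \<Rightarrow> nat) \<Rightarrow> rule set \<Rightarrow> 'r fo rel" where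
  "PFO_equiv ar Rs = {(\<phi>, \<psi>). \<phi> \<in> PFO ar \<and> \<psi> \<in> PFO ar \<and> equivclp (rewr Rs) \<phi> \<psi>}"

lemma equiv_PFO_equiv: "equiv (PFO ar) (PFO_equiv ar Rs)"
  by (rule equivI)
    (auto simp: PFO_equiv_def refl_on_def sym_def trans_def
      intro: equivclp_sym equivclp_trans)

text \<open>A gauged system: carrier, relation on the carrier, gauge. Only the values of the gauge on
  the carrier matter.\<close>

type_synonym 'd gauged_system = "'d set \<times> 'd rel \<times> ('d \<Rightarrow> real)"

definition gauged_monotone :: "'d gauged_system \<Rightarrow> bool" where
  "gauged_monotone = (\<lambda>(D, r, g). \<forall>d \<in> D. \<forall>e \<in> D. (d, e) \<in> r \<longrightarrow> g d \<ge> g e)"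

definition gauged_quotient :: "'d gauged_system \<Rightarrow> 'd rel \<Rightarrow> 'd set gauged_system" where
  "gauged_quotient = (\<lambda>(D, r, g) E.
     (D // E,
      {(C, C'). C \<in> D // E \<and> C' \<in> D // E \<and> (\<exists>d \<in> C. \<exists>d' \<in> C'. (d, d') \<in> r)},
      (\<lambda>C. INF d \<in> C. g d)))"

definition PFO_width_system :: "('r \<Rightarrow> nat) \<Rightarrow> rule set \<Rightarrow> 'r fo gauged_system" where
  "PFO_width_system ar Rs = (PFO ar, PFO_rewr ar Rs, (\<lambda>\<phi>. real (width \<phi>)))"

end

theory Submission
  imports Defs
begin

text \<open>Renaming bound variables changes no widths, so one may work with formulas whose bound
  variables are pairwise distinct and distinct from the free ones. Along a \<open>\<T>\<close>-derivation the
  renaming steps then disappear, and only associativity, commutativity, reordering and the two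
  pushing rules remain; write \<open>\<approx>\<close> for the equivalence they generate. These rules only act inside
  maximal \<open>\<and>\<close>/\<open>\<exists>\<close>- or \<open>\<or>\<close>/\<open>\<forall>\<close>-regions of the syntax tree.
  A step with \<open>M\<close> or \<open>S\<down>\<close> is generalized to an operation on such a region: delete a quantifier
  \<open>Qx\<close>, and then, for \<open>S\<down>\<close>, descend to one child of the region below which all occurrences of \<open>x\<close>
  lie and replace it by \<open>Qx F\<^sub>1 \<oplus> Qx F\<^sub>2\<close>, where \<open>F\<^sub>1 \<oplus> F\<^sub>2\<close> is any formula \<open>\<approx>\<close>-equivalent to that
  child. In this generality the step commutes with \<open>\<approx>\<close>, so it can be performed on every
  representative of the class. It does not increase the width, provided \<open>F\<^sub>1\<close> and \<open>F\<^sub>2\<close> are chosen well: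
  if \<open>F \<approx> F\<^sub>1 \<oplus> F\<^sub>2\<close>, then, after deleting the vacuous quantifiers, restricting the syntax tree of
  \<open>F\<close> to the children that belong to \<open>F\<^sub>i\<close> gives a formula equivalent to \<open>F\<^sub>i\<close> of at most the same
  width.\<close>

section \<open>Bound variables, well-named formulas and widths\<close>

fun conn_of :: "quant \<Rightarrow> conn" where
  "conn_of Ex = And"
| "conn_of All = Or"

fun bound :: "'r fo \<Rightarrow> var set" where
  "bound (Atom r xs) = {}"
| "bound (Neg F) = bound F"
| "bound (Bin c F G) = bound F \<union> bound G"
| "bound (Quant q x F) = insert x (bound F)"

text \<open>The variable convention: no variable is bound twice and none is both free and bound.
  Vacuous quantifiers are allowed.\<close>

fun well_named :: "'r fo \<Rightarrow> bool" where
  "well_named (Atom r xs) \<longleftrightarrow> True"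
| "well_named (Neg F) \<longleftrightarrow> well_named F"
| "well_named (Bin c F G) \<longleftrightarrow> well_named F \<and> well_named G \<and> bound F \<inter> bound G = {} \<and>
     bound F \<inter> free G = {} \<and> free F \<inter> bound G = {}"
| "well_named (Quant q x F) \<longleftrightarrow> well_named F \<and> x \<notin> bound F"

lemma conn_of_inject [simp]: "conn_of p = conn_of q \<longleftrightarrow> p = q"
  by (cases p; cases q) auto

lemma finite_free [simp]: "finite (free F)"
  by (induction F) auto

lemma finite_bound [simp]: "finite (bound F)"
  by (induction F) auto

lemma well_named_disjoint: "well_named F \<Longrightarrow> free F \<inter> bound F = {}"
  by (induction F) auto

lemma finite_subformulas [simp]: "finite (subformulas F)"
  by (induction F) auto

lemma subformulas_self [simp]: "F \<in> subformulas F"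
  by (cases F) auto

lemma card_free_le_width: "card (free F) \<le> width F"
  unfolding width_def by (intro Max_ge) auto

lemma width_Neg [simp]: "width (Neg F) = width F"
proof -
  have "subformulas F \<noteq> {}"
    using subformulas_self by blast
  then show ?thesis
    using card_free_le_width[of F] by (simp add: width_def)
qed

lemma width_Atom [simp]: "width (Atom r xs) = card (set xs)"
  by (simp add: width_def)

lemma width_Bin [simp]:
  "width (Bin c F G) = max (card (free F \<union> free G)) (max (width F) (width G))"
proof -
  have "subformulas F \<noteq> {}" "subformulas G \<noteq> {}"
    using subformulas_self by blast+
  then show ?thesis
    by (simp add: width_def image_Un Max_Un)
qed

text \<open>A quantifier node has no more free variables than its body and so never attains the
  maximum alone. Width estimates therefore concern atoms and binary nodes only.\<close>

lemma width_Quant [simp]: "width (Quant q x F) = width F"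
proof -
  have "card (free F - {x}) \<le> card (free F)"
    by (simp add: card_mono)
  also have "\<dots> \<le> width F"
    by (rule card_free_le_width)
  finally have "max (card (free F - {x})) (width F) = width F"
    by simp
  moreover have "subformulas F \<noteq> {}"
    using subformulas_self by blast
  ultimately show ?thesis
    by (simp add: width_def)
qed

section \<open>The equivalence generated by the rules other than renaming\<close>

inductive acop :: "'r fo \<Rightarrow> 'r fo \<Rightarrow> bool" where
  assocl: "acop (Bin c A (Bin c B C)) (Bin c (Bin c A B) C)"
| assocr: "acop (Bin c (Bin c A B) C) (Bin c A (Bin c B C))"
| comm: "acop (Bin c A B) (Bin c B A)"
| swap: "acop (Quant q x (Quant q y A)) (Quant q y (Quant q x A))"
| push: "x \<notin> free B \<Longrightarrow>
    acop (Quant q x (Bin (conn_of q) A B)) (Bin (conn_of q) (Quant q x A) B)"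
| pull: "x \<notin> free B \<Longrightarrow>
    acop (Bin (conn_of q) (Quant q x A) B) (Quant q x (Bin (conn_of q) A B))"
| neg: "acop A B \<Longrightarrow> acop (Neg A) (Neg B)"
| left: "acop A B \<Longrightarrow> acop (Bin c A C) (Bin c B C)"
| right: "acop A B \<Longrightarrow> acop (Bin c C A) (Bin c C B)"
| quant: "acop A B \<Longrightarrow> acop (Quant q x A) (Quant q x B)"

abbreviation acop_eq (infix "\<approx>" 50) where
  "F \<approx> G \<equiv> acop\<^sup>*\<^sup>* F G"

text \<open>The rules come in inverse pairs or are their own inverses, so the reflexive-transitive
  closure is already an equivalence.\<close>

lemma acop_sym: "acop F G \<Longrightarrow> acop G F"
  by (induction rule: acop.induct) (auto intro: acop.intros)

lemma acop_eq_sym: "F \<approx> G \<Longrightarrow> G \<approx> F"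
  by (induction rule: rtranclp_induct) (auto intro: acop_sym converse_rtranclp_into_rtranclp)

lemma acop_free: "acop F G \<Longrightarrow> free F = free G"
  by (induction rule: acop.induct) auto

lemma acop_bound: "acop F G \<Longrightarrow> bound F = bound G"
  by (induction rule: acop.induct) auto

text \<open>No rule changes the free or the bound variables, so the variable convention, once
  established, survives a whole derivation.\<close>

lemma acop_well_named: "acop F G \<Longrightarrow> well_named F \<Longrightarrow> well_named G"
  by (induction rule: acop.induct) (use acop_free acop_bound in \<open>auto; blast\<close>)+

lemma acop_eq_free: "F \<approx> G \<Longrightarrow> free F = free G"
  by (induction rule: rtranclp_induct) (auto dest: acop_free)

lemma acop_eq_well_named: "F \<approx> G \<Longrightarrow> well_named F \<Longrightarrow> well_named G"
  by (induction rule: rtranclp_induct) (auto dest: acop_well_named)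

lemma acop_eq_Neg: "A \<approx> B \<Longrightarrow> Neg A \<approx> Neg B"
  by (induction rule: rtranclp_induct) (auto intro: rtranclp.rtrancl_into_rtrancl acop.neg)

lemma acop_eq_Quant: "A \<approx> B \<Longrightarrow> Quant q x A \<approx> Quant q x B"
  by (induction rule: rtranclp_induct) (auto intro: rtranclp.rtrancl_into_rtrancl acop.quant)

lemma acop_eq_left: "A \<approx> B \<Longrightarrow> Bin c A C \<approx> Bin c B C"
  by (induction rule: rtranclp_induct) (auto intro: rtranclp.rtrancl_into_rtrancl acop.left)

lemma acop_eq_right: "A \<approx> B \<Longrightarrow> Bin c C A \<approx> Bin c C B"
  by (induction rule: rtranclp_induct) (auto intro: rtranclp.rtrancl_into_rtrancl acop.right)

lemma acop_eq_Bin: "A \<approx> A' \<Longrightarrow> B \<approx> B' \<Longrightarrow> Bin c A B \<approx> Bin c A' B'"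
  by (meson acop_eq_left acop_eq_right rtranclp_trans)

text \<open>The kind of region that the root lies in: a quantifier counts as the connective it can
  be exchanged with. Invariance under \<open>\<approx>\<close> is what separates a region from its
  children.\<close>

fun root_conn :: "'r fo \<Rightarrow> conn option" where
  "root_conn (Atom r xs) = None"
| "root_conn (Neg F) = None"
| "root_conn (Bin c F G) = Some c"
| "root_conn (Quant q x F) = Some (conn_of q)"

lemma acop_root_conn: "acop F G \<Longrightarrow> root_conn F = root_conn G"
  by (induction rule: acop.induct) auto

lemma acop_eq_root_conn: "F \<approx> G \<Longrightarrow> root_conn F = root_conn G"
  by (induction rule: rtranclp_induct) (auto dest: acop_root_conn)

section \<open>Deleting a quantifier from a region\<close>

inductive del :: "quant \<Rightarrow> var \<Rightarrow> 'r fo \<Rightarrow> 'r fo \<Rightarrow> bool" for q x where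
  here: "del q x (Quant q x A) A"
| left: "del q x A A' \<Longrightarrow> del q x (Bin (conn_of q) A B) (Bin (conn_of q) A' B)"
| right: "del q x B B' \<Longrightarrow> del q x (Bin (conn_of q) A B) (Bin (conn_of q) A B')"
| quant: "del q x A A' \<Longrightarrow> del q x (Quant q y A) (Quant q y A')"

inductive_cases del_AtomE: "del q x (Atom r xs) G"
  and del_NegE: "del q x (Neg A) G"
  and del_BinE: "del q x (Bin c A B) G"
  and del_QuantE: "del q x (Quant p y A) G"

lemmas del_cases = del_AtomE del_NegE del_BinE del_QuantE
lemmas acop_intros = acop.intros[THEN r_into_rtranclp[of acop]]

lemma del_bound: "del q x F F' \<Longrightarrow> x \<in> bound F"
  by (induction rule: del.induct) auto

text \<open>As \<open>x\<close> is bound only once, the siblings passed on the way to its binder do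
  not contain it; deletion just turns \<open>x\<close> from a bound into a possibly free variable.
  The drop in size drives the induction in \<open>split_width\<close>.\<close>

lemma del_facts: "del q x F F' \<Longrightarrow> well_named F \<Longrightarrow>
   well_named F' \<and> free F = free F' - {x} \<and> bound F' = bound F - {x} \<and> size F' < size F"
proof (induction rule: del.induct)
  case (here A) then show ?case by (auto dest: well_named_disjoint)
next
  case (left A A' B)
  then have "x \<in> bound A" by (auto dest: del_bound)
  with left show ?case by auto
next
  case (right B B' A)
  then have "x \<in> bound B" by (auto dest: del_bound)
  with right show ?case by auto
next
  case (quant A A' y)
  then have "x \<in> bound A" by (auto dest: del_bound)
  with quant show ?case by auto
qed

text \<open>Each rule only rearranges a region, so the binder deleted in \<open>G\<close> has a
  counterpart in \<open>F\<close>. After both deletions the same step applies again, or the results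
  coincide because the moved binder is the deleted one.\<close>

lemma del_acop:
  "acop F G \<Longrightarrow> well_named F \<Longrightarrow> del q x G G' \<Longrightarrow> \<exists>F'. del q x F F' \<and> F' \<approx> G'"
proof (induction arbitrary: G' rule: acop.induct)
  case (assocl c A B C)
  from assocl(2) show ?case
    by (auto elim!: del_cases intro: del.intros acop_intros)
next
  case (assocr c A B C)
  from assocr(2) show ?case
    by (auto elim!: del_cases intro: del.intros acop_intros)
next
  case (comm c A B)
  from comm(2) show ?case
    by (auto elim!: del_cases intro: del.intros acop_intros)
next
  case (swap p u v A)
  from swap(2) show ?case
    by (auto elim!: del_cases intro: del.intros acop_intros)
next
  case (push u B p A)
  \<comment> \<open>Deletion inside \<open>B\<close> may expose \<open>x\<close>; well-namedness
    gives \<open>x \<noteq> u\<close>, so the side condition of the rule survives.\<close>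
  have fresh: "u \<notin> free B'" if "del q x B B'" for B'
    using push.prems(1) push.hyps del_facts[OF that] del_bound[OF that] by auto
  from push.prems(2) push.hyps fresh show ?case
    by (fastforce elim!: del_cases intro: del.intros acop_intros)
next
  case (pull u B p A)
  have fresh: "u \<notin> free B'" if "del q x B B'" for B'
    using pull.prems(1) pull.hyps del_facts[OF that] del_bound[OF that] by auto
  from pull.prems(2) pull.hyps fresh show ?case
    by (auto elim!: del_cases intro: del.intros acop_intros)
next
  case (neg A B)
  then show ?case by (auto elim!: del_cases)
next
  case (left A B c C)
  from left.prems left.hyps left.IH show ?case
    by (fastforce elim!: del_cases intro: del.intros acop_intros acop_eq_left)
next
  case (right A B c C)
  from right.prems right.hyps right.IH show ?case
    by (fastforce elim!: del_cases intro: del.intros acop_intros acop_eq_right)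
next
  case (quant A B p y)
  from quant.prems quant.hyps quant.IH show ?case
    by (fastforce elim!: del_cases intro: del.intros acop_intros acop_eq_Quant)
qed

lemma del_acop_eq:
  "F \<approx> G \<Longrightarrow> well_named F \<Longrightarrow> del q x G G' \<Longrightarrow> \<exists>F'. del q x F F' \<and> F' \<approx> G'"
proof (induction arbitrary: G' rule: rtranclp_induct)
  case (step G H)
  from step.hyps step.prems obtain G1 where "del q x G G1" "G1 \<approx> G'"
    using del_acop acop_eq_well_named by blast
  with step.IH step.prems show ?case
    by (meson rtranclp_trans)
qed blast

text \<open>Well-namedness keeps \<open>x\<close> out of all siblings on the path to its binder, so
  the binder can be pulled up to the root. This is how \<open>split_width\<close> puts a deleted
  quantifier back.\<close>

lemma del_acop_eq_Quant: "del q x F F' \<Longrightarrow> well_named F \<Longrightarrow> F \<approx> Quant q x F'"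
proof (induction rule: del.induct)
  case (left A A' B)
  then have "x \<notin> free B"
    by (auto dest: del_bound)
  moreover have "Bin (conn_of q) A B \<approx> Bin (conn_of q) (Quant q x A') B"
    using left by (auto intro: acop_eq_left)
  ultimately show ?case
    by (meson acop.pull rtranclp.rtrancl_into_rtrancl)
next
  case (right B B' A)
  then have "x \<notin> free A"
    by (auto dest: del_bound)
  then have "Bin (conn_of q) (Quant q x B') A \<approx> Quant q x (Bin (conn_of q) B' A)"
    by (rule acop_intros)
  moreover have "Bin (conn_of q) A B \<approx> Bin (conn_of q) A (Quant q x B')"
    using right by (auto intro: acop_eq_right)
  moreover have "Quant q x (Bin (conn_of q) B' A) \<approx> Quant q x (Bin (conn_of q) A B')"
    by (intro acop_eq_Quant acop_intros)
  ultimately show ?case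
    by (meson acop.comm rtranclp.rtrancl_into_rtrancl rtranclp_trans)
next
  case (quant A A' y)
  then have "Quant q y A \<approx> Quant q y (Quant q x A')"
    by (auto intro: acop_eq_Quant)
  then show ?case
    by (meson acop.swap rtranclp.rtrancl_into_rtrancl)
qed blast

text \<open>Deleting a vacuous binder changes no set of free variables above it; otherwise the
  exposed \<open>x\<close> could enlarge them.\<close>

lemma width_del: "del q x F F' \<Longrightarrow> well_named F \<Longrightarrow> x \<notin> free F' \<Longrightarrow> width F' \<le> width F"
proof (induction rule: del.induct)
  case (left A A' B)
  with del_facts[of q x A A'] show ?case by auto
next
  case (right B B' A)
  with del_facts[of q x B B'] show ?case by auto
next
  case (quant A A' y)
  with del_bound[of q x A A'] show ?case by auto
qed auto

text \<open>\<open>essential q F\<close>: no quantifier in the root region of \<open>F\<close> is vacuous. A vacuous quantifier has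
  no fixed place among the children of its region, so \<open>part\<close> below respects \<open>\<approx>\<close> only without them.\<close>

fun essential :: "quant \<Rightarrow> 'r fo \<Rightarrow> bool" where
  "essential q (Bin c A B) \<longleftrightarrow> (c = conn_of q \<longrightarrow> essential q A \<and> essential q B)"
| "essential q (Quant p x A) \<longleftrightarrow> (p = q \<longrightarrow> x \<in> free A \<and> essential q A)"
| "essential q _ \<longleftrightarrow> True"

lemma essential_acop: "acop F G \<Longrightarrow> essential q F = essential q G"
  by (induction rule: acop.induct) (auto dest: acop_free)

lemma essential_acop_eq: "F \<approx> G \<Longrightarrow> essential q F = essential q G"
  by (induction rule: rtranclp_induct) (auto dest: essential_acop)

text \<open>A failure of \<open>essential\<close> yields a vacuous binder of the region. The
  siblings do not contain its variable either, so deleting it exposes nothing.\<close>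

lemma not_essentialE:
  assumes "\<not> essential q F" "well_named F"
  obtains y F' where "del q y F F'" "y \<notin> free F'"
proof -
  have "\<exists>y F'. del q y F F' \<and> y \<notin> free F'"
    using assms
  proof (induction F)
    case (Bin c A B)
    then have [simp]: "c = conn_of q" by auto
    show ?case
    proof (cases "essential q A")
      case True
      with Bin obtain y B' where "del q y B B'" "y \<notin> free B'" by auto
      moreover from this Bin.prems have "y \<notin> free A"
        by (auto dest: del_bound)
      ultimately show ?thesis
        by (auto intro!: exI del.right)
    next
      case False
      with Bin obtain y A' where "del q y A A'" "y \<notin> free A'" by auto
      moreover from this Bin.prems have "y \<notin> free B"
        by (auto dest: del_bound)
      ultimately show ?thesis
        by (auto intro!: exI del.left)
    qed
  next
    case (Quant p x A)
    then show ?case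
      by (cases "x \<in> free A") (fastforce intro: del.intros)+
  qed auto
  then show ?thesis using that by blast
qed

section \<open>Splitting a region into two parts\<close>

text \<open>\<open>None\<close> is neutral, so a single rule of \<open>part\<close> also covers a
  binary node one of whose children goes entirely to one side.\<close>

fun join :: "conn \<Rightarrow> 'r fo option \<Rightarrow> 'r fo option \<Rightarrow> 'r fo option" where
  "join c None b = b"
| "join c a None = a"
| "join c (Some A) (Some B) = Some (Bin c A B)"

fun ofree :: "'r fo option \<Rightarrow> var set" where
  "ofree None = {}"
| "ofree (Some A) = free A"

fun owidth :: "'r fo option \<Rightarrow> nat" where
  "owidth None = 0"
| "owidth (Some A) = width A"

abbreviation "oeq \<equiv> rel_option acop\<^sup>*\<^sup>*"

lemma join_None [simp]: "join c a None = a"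
  by (cases a) auto

lemma ofree_join [simp]: "ofree (join c a b) = ofree a \<union> ofree b"
  by (cases a; cases b) auto

lemma join_cong: "oeq a a' \<Longrightarrow> oeq b b' \<Longrightarrow> oeq (join c a b) (join c a' b')"
  by (cases a; cases a'; cases b; cases b') (auto intro: acop_eq_Bin)

lemma join_assoc: "oeq (join c (join c a b) d) (join c a (join c b d))"
  by (cases a; cases b; cases d) (auto intro: acop_intros)

lemma join_assoc': "oeq (join c a (join c b d)) (join c (join c a b) d)"
  by (cases a; cases b; cases d) (auto intro: acop_intros)

lemma join_comm: "oeq (join c a b) (join c b a)"
  by (cases a; cases b) (auto intro: acop_intros)

lemma oeq_refl [simp]: "oeq a a"
  by (simp add: option.rel_refl)

lemma oeq_ofree: "oeq a b \<Longrightarrow> ofree a = ofree b"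
  by (cases a; cases b) (auto dest: acop_eq_free)

text \<open>\<open>part q F a b\<close> distributes the children of the root region of \<open>F\<close> over two formulas; \<open>None\<close> stands
  for a side that received no child.\<close>

inductive part :: "quant \<Rightarrow> 'r fo \<Rightarrow> 'r fo option \<Rightarrow> 'r fo option \<Rightarrow> bool" for q where
  all_left: "part q A (Some A) None"
| all_right: "part q A None (Some A)"
| Bin: "part q A a1 a2 \<Longrightarrow> part q B b1 b2 \<Longrightarrow>
    part q (Bin (conn_of q) A B) (join (conn_of q) a1 b1) (join (conn_of q) a2 b2)"
| quant_left: "part q A (Some A1) a2 \<Longrightarrow> y \<notin> ofree a2 \<Longrightarrow>
    part q (Quant q y A) (Some (Quant q y A1)) a2"
| quant_right: "part q A a1 (Some A2) \<Longrightarrow> y \<notin> ofree a1 \<Longrightarrow>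
    part q (Quant q y A) a1 (Some (Quant q y A2))"

lemma part_ofree: "part q F a b \<Longrightarrow> ofree a \<union> ofree b = free F"
  by (induction rule: part.induct) auto

lemma owidth_join:
  "owidth (join c a b) \<le> max (card (ofree a \<union> ofree b)) (max (owidth a) (owidth b))"
  by (cases a; cases b) auto

text \<open>Every node of a part comes from a node of \<open>F\<close> by dropping children, and its
  free variables are among those of that node.\<close>

lemma part_owidth: "part q F a b \<Longrightarrow> owidth a \<le> width F \<and> owidth b \<le> width F"
proof (induction rule: part.induct)
  case (Bin A a1 a2 B b1 b2)
  have "ofree a1 \<union> ofree b1 \<subseteq> free A \<union> free B" "ofree a2 \<union> ofree b2 \<subseteq> free A \<union> free B"
    using Bin.hyps[THEN part_ofree] by auto
  then have "card (ofree a1 \<union> ofree b1) \<le> card (free A \<union> free B)"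
    "card (ofree a2 \<union> ofree b2) \<le> card (free A \<union> free B)"
    by (auto intro!: card_mono)
  then show ?case
    using Bin.IH owidth_join[of "conn_of q" a1 b1] owidth_join[of "conn_of q" a2 b2] by auto
qed auto

text \<open>Handing over a whole node amounts to handing over both of its children, so inversion can
  always produce the divided form.\<close>

lemma part_BinE:
  assumes "part q (Bin (conn_of q) A B) p1 p2"
  obtains a1 a2 b1 b2 where "part q A a1 a2" "part q B b1 b2"
    "p1 = join (conn_of q) a1 b1" "p2 = join (conn_of q) a2 b2"
  using assms
proof (cases rule: part.cases)
  case all_left
  then show ?thesis
    using that[of "Some A" None "Some B" None] by (auto intro: part.intros)
next
  case all_right
  then show ?thesis
    using that[of None "Some A" None "Some B"] by (auto intro: part.intros)
qed (auto intro: that)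

lemma part_QuantE:
  assumes "part q (Quant q y A) p1 p2"
  obtains A1 where "part q A (Some A1) p2" "y \<notin> ofree p2" "p1 = Some (Quant q y A1)"
  | A2 where "part q A p1 (Some A2)" "y \<notin> ofree p1" "p2 = Some (Quant q y A2)"
  using assms by (cases rule: part.cases) (auto intro: that part.intros)

lemma part_otherE:
  assumes "part q F p1 p2" "root_conn F \<noteq> Some (conn_of q)"
  obtains "p1 = Some F" "p2 = None" | "p1 = None" "p2 = Some F"
  using assms by (cases rule: part.cases) (auto intro: that)

lemma part_acop_other:
  assumes "acop F G" "root_conn G \<noteq> Some (conn_of q)" "part q G p1 p2"
  shows "\<exists>r1 r2. part q F r1 r2 \<and> oeq r1 p1 \<and> oeq r2 p2"
  using assms(3,2)
proof (cases rule: part_otherE)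
  case 1
  then show ?thesis
    using assms(1) by (intro exI[of _ "Some F"] exI[of _ None]) (auto intro: part.intros)
next
  case 2
  then show ?thesis
    using assms(1) by (intro exI[of _ None] exI[of _ "Some F"]) (auto intro: part.intros)
qed

text \<open>Rearranging a region permutes its children, so a distribution of the children of
  \<open>G\<close> is also one of those of \<open>F\<close>, and the resulting parts differ only by
  rearrangement. The delicate point is which side a quantifier follows; for this \<open>F\<close>
  has to be essential.\<close>

lemma part_acop:
  "acop F G \<Longrightarrow> essential q F \<Longrightarrow> part q G p1 p2 \<Longrightarrow>
    \<exists>r1 r2. part q F r1 r2 \<and> oeq r1 p1 \<and> oeq r2 p2"
proof (induction arbitrary: p1 p2 rule: acop.induct)
  case (assocl c A B C)
  show ?case
  proof (cases "c = conn_of q")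
    case True
    with assocl show ?thesis
      by (auto elim!: part_BinE) (meson join_assoc' part.Bin)
  qed (use assocl in \<open>auto intro: part_acop_other acop.intros\<close>)
next
  case (assocr c A B C)
  show ?case
  proof (cases "c = conn_of q")
    case True
    with assocr show ?thesis
      by (auto elim!: part_BinE) (meson join_assoc part.Bin)
  qed (use assocr in \<open>auto intro: part_acop_other acop.intros\<close>)
next
  case (comm c A B)
  show ?case
  proof (cases "c = conn_of q")
    case True
    with comm show ?thesis
      by (auto elim!: part_BinE) (meson join_comm part.Bin)
  qed (use comm in \<open>auto intro: part_acop_other acop.intros\<close>)
next
  case (swap p x y A)
  show ?case
  proof (cases "p = q \<and> x \<noteq> y")
    case True
    then have [simp]: "p = q" "x \<noteq> y" "y \<noteq> x" by auto
    from swap(2) have "part q (Quant q y (Quant q x A)) p1 p2"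
      by simp
    \<comment> \<open>Two quantifiers on the same side are swapped inside that part; on different
      sides the parts remain as they are.\<close>
    then show ?thesis
    proof (cases rule: part_QuantE)
      case (1 A1)
      note outer = this
      from 1(1) show ?thesis
      proof (cases rule: part_QuantE)
        case (1 A2)
        with outer show ?thesis
          by (intro exI[of _ "Some (Quant q x (Quant q y A2))"] exI[of _ p2])
            (auto intro: part.intros acop_intros)
      next
        case (2 A2)
        with outer show ?thesis
          by (intro exI[of _ p1] exI[of _ p2]) (auto intro!: part.intros)
      qed
    next
      case (2 A1)
      note outer = this
      from 2(1) show ?thesis
      proof (cases rule: part_QuantE)
        case (1 A2)
        with outer show ?thesis
          by (intro exI[of _ p1] exI[of _ p2]) (auto intro!: part.intros)
      next
        case (2 A2)
        with outer show ?thesis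
          by (intro exI[of _ p1] exI[of _ "Some (Quant q x (Quant q y A2))"])
            (auto intro: part.intros acop_intros)
      qed
    qed
  next
    case False
    then consider "p \<noteq> q" | "x = y" by blast
    then show ?thesis
    proof cases
      case 1
      with swap show ?thesis
        by (auto intro: part_acop_other acop.intros)
    next
      case 2
      with swap show ?thesis
        by (intro exI[of _ p1] exI[of _ p2]) auto
    qed
  qed
next
  case (push x B p A)
  show ?case
  proof (cases "p = q")
    case [simp]: True
    from push(3) obtain a1 a2 b1 b2 where a: "part q (Quant q x A) a1 a2"
      and b: "part q B b1 b2"
      and p: "p1 = join (conn_of q) a1 b1" "p2 = join (conn_of q) a2 b2"
      by (auto elim: part_BinE)
    have x: "x \<notin> ofree b1" "x \<notin> ofree b2"
      using push(1) part_ofree[OF b] by auto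
    from a show ?thesis
    proof (cases rule: part_QuantE)
      case (1 A1)
      have ab: "part q (Bin (conn_of q) A B) (join (conn_of q) (Some A1) b1) p2"
        using p part.Bin[OF 1(1) b] by simp
      show ?thesis
      proof (cases b1)
        case None
        with ab 1 p x show ?thesis
          by (intro exI[of _ p1] exI[of _ p2]) (auto intro!: part.intros)
      next
        case (Some B1)
        with ab 1 p x show ?thesis
          by (intro exI[of _ "Some (Quant q x (Bin (conn_of q) A1 B1))"] exI[of _ p2])
            (auto intro!: part.intros acop_intros)
      qed
    next
      case (2 A2)
      have ab: "part q (Bin (conn_of q) A B) p1 (join (conn_of q) (Some A2) b2)"
        using p part.Bin[OF 2(1) b] by simp
      show ?thesis
      proof (cases b2)
        case None
        with ab 2 p x show ?thesis
          by (intro exI[of _ p1] exI[of _ p2]) (auto intro!: part.intros)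
      next
        case (Some B2)
        with ab 2 p x show ?thesis
          by (intro exI[of _ p1] exI[of _ "Some (Quant q x (Bin (conn_of q) A2 B2))"])
            (auto intro!: part.intros acop_intros)
      qed
    qed
  qed (use push in \<open>auto intro: part_acop_other acop.intros\<close>)
next
  case (pull x B p A)
  show ?case
  proof (cases "p = q")
    case [simp]: True
    \<comment> \<open>\<open>essential\<close> places \<open>x\<close> in \<open>A\<close>. Hence
      the side that received the quantifier also received a part of \<open>A\<close> to carry it in
      \<open>F\<close>; a vacuous quantifier could have gone with children of \<open>B\<close>
      only.\<close>
    have xA: "x \<in> free A"
      using pull(2) by simp
    from pull(3) have "part q (Quant q x (Bin (conn_of q) A B)) p1 p2"
      by simp
    then show ?thesis
    proof (cases rule: part_QuantE)
      case (1 X)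
      from 1(1) obtain a1 a2 b1 b2 where a: "part q A a1 a2" and b: "part q B b1 b2"
        and p: "Some X = join (conn_of q) a1 b1" "p2 = join (conn_of q) a2 b2"
        by (auto elim: part_BinE)
      have x: "x \<notin> ofree b1" "x \<notin> ofree a2" "x \<in> ofree a1"
        using 1(2) pull(1) part_ofree[OF a] part_ofree[OF b] xA p by auto
      then obtain A1 where A1: "a1 = Some A1"
        by (cases a1) auto
      have *: "part q (Bin (conn_of q) (Quant q x A) B)
          (join (conn_of q) (Some (Quant q x A1)) b1) p2"
        using p a b x A1 by (auto intro!: part.intros)
      have "oeq (join (conn_of q) (Some (Quant q x A1)) b1) p1"
        using p 1 A1 x by (cases b1) (auto intro!: acop_intros)
      with * show ?thesis
        unfolding True using oeq_refl by blast
    next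
      case (2 X)
      from 2(1) obtain a1 a2 b1 b2 where a: "part q A a1 a2" and b: "part q B b1 b2"
        and p: "p1 = join (conn_of q) a1 b1" "Some X = join (conn_of q) a2 b2"
        by (auto elim: part_BinE)
      have x: "x \<notin> ofree b2" "x \<notin> ofree a1" "x \<in> ofree a2"
        using 2(2) pull(1) part_ofree[OF a] part_ofree[OF b] xA p by auto
      then obtain A2 where A2: "a2 = Some A2"
        by (cases a2) auto
      have *: "part q (Bin (conn_of q) (Quant q x A) B)
          p1 (join (conn_of q) (Some (Quant q x A2)) b2)"
        using p a b x A2 by (auto intro!: part.intros)
      have "oeq (join (conn_of q) (Some (Quant q x A2)) b2) p2"
        using p 2 A2 x by (cases b2) (auto intro!: acop_intros)
      with * show ?thesis
        unfolding True using oeq_refl by blast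
    qed
  qed (use pull in \<open>auto intro: part_acop_other acop.intros\<close>)
next
  case (neg A B)
  then show ?case
    by (auto intro: part_acop_other acop.intros)
next
  case (left A B c C)
  show ?case
  proof (cases "c = conn_of q")
    case [simp]: True
    from left.prems(2) obtain a1 a2 b1 b2 where a: "part q B a1 a2" and b: "part q C b1 b2"
        and p: "p1 = join (conn_of q) a1 b1" "p2 = join (conn_of q) a2 b2"
      by (auto elim: part_BinE)
    from left.IH[OF _ a] left.prems obtain r1 r2
      where "part q A r1 r2" "oeq r1 a1" "oeq r2 a2" by auto
    with b p show ?thesis
      unfolding True by (meson join_cong oeq_refl part.Bin)
  qed (use left in \<open>auto intro: part_acop_other acop.intros\<close>)
next
  case (right A B c C)
  show ?case
  proof (cases "c = conn_of q")
    case [simp]: True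
    from right.prems(2) obtain a1 a2 b1 b2 where a: "part q C a1 a2" and b: "part q B b1 b2"
        and p: "p1 = join (conn_of q) a1 b1" "p2 = join (conn_of q) a2 b2"
      by (auto elim: part_BinE)
    from right.IH[OF _ b] right.prems obtain r1 r2
      where "part q A r1 r2" "oeq r1 b1" "oeq r2 b2" by auto
    with a p show ?thesis
      unfolding True by (meson join_cong oeq_refl part.Bin)
  qed (use right in \<open>auto intro: part_acop_other acop.intros\<close>)
next
  case (quant A B p y)
  show ?case
  proof (cases "p = q")
    case [simp]: True
    from quant.prems(2) have "part q (Quant q y B) p1 p2" by simp
    then show ?thesis
    proof (cases rule: part_QuantE)
      case (1 B1)
      from quant.IH[OF _ 1(1)] quant.prems obtain A1 r2
        where A1: "part q A (Some A1) r2" "A1 \<approx> B1" "oeq r2 p2"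
        by (auto simp: option_rel_Some2)
      then have "part q (Quant q y A) (Some (Quant q y A1)) r2"
        using 1(2) by (auto intro!: part.intros dest: oeq_ofree)
      moreover have "oeq (Some (Quant q y A1)) p1"
        using A1 1 by (auto intro: acop_eq_Quant)
      ultimately show ?thesis
        unfolding True using A1 by blast
    next
      case (2 B2)
      from quant.IH[OF _ 2(1)] quant.prems obtain A2 r1
        where A2: "part q A r1 (Some A2)" "A2 \<approx> B2" "oeq r1 p1"
        by (auto simp: option_rel_Some2)
      then have "part q (Quant q y A) r1 (Some (Quant q y A2))"
        using 2(2) by (auto intro!: part.intros dest: oeq_ofree)
      moreover have "oeq (Some (Quant q y A2)) p2"
        using A2 2 by (auto intro: acop_eq_Quant)
      ultimately show ?thesis
        unfolding True using A2 by blast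
    qed
  qed (use quant in \<open>auto intro: part_acop_other acop.intros\<close>)
qed

lemma oeq_trans: "oeq a b \<Longrightarrow> oeq b c \<Longrightarrow> oeq a c"
  by (cases a; cases b; cases c) auto

lemma part_acop_eq:
  "F \<approx> G \<Longrightarrow> essential q F \<Longrightarrow> part q G p1 p2 \<Longrightarrow>
    \<exists>r1 r2. part q F r1 r2 \<and> oeq r1 p1 \<and> oeq r2 p2"
proof (induction arbitrary: p1 p2 rule: rtranclp_induct)
  case base
  then show ?case
    by (auto intro!: exI)
next
  case (step G H)
  from step.hyps step.prems obtain s1 s2 where "part q G s1 s2" "oeq s1 p1" "oeq s2 p2"
    using part_acop essential_acop_eq by blast
  with step.IH step.prems show ?case
    by (meson oeq_trans)
qed

text \<open>On the right, \<open>G1\<close> goes to one side and \<open>G2\<close> to the other;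
  this distribution is transported to \<open>F\<close>, where \<open>part_owidth\<close> bounds both
  parts.\<close>

lemma essential_split_width:
  assumes "F \<approx> Bin (conn_of q) G1 G2" "essential q F"
  shows "\<exists>F1 F2. F1 \<approx> G1 \<and> F2 \<approx> G2 \<and> width F1 \<le> width F \<and> width F2 \<le> width F"
proof -
  have "part q (Bin (conn_of q) G1 G2) (join (conn_of q) (Some G1) None) (join (conn_of q) None (Some G2))"
    by (intro part.intros)
  then have "part q (Bin (conn_of q) G1 G2) (Some G1) (Some G2)"
    by simp
  from part_acop_eq[OF assms this] obtain F1 F2
    where "part q F (Some F1) (Some F2)" "F1 \<approx> G1" "F2 \<approx> G2"
    by (auto simp: option_rel_Some2)
  moreover from this have "width F1 \<le> width F" "width F2 \<le> width F"
    by (auto dest!: part_owidth)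
  ultimately show ?thesis by blast
qed

text \<open>Induction on the size of the two parts. A vacuous quantifier of \<open>G1\<close> or
  \<open>G2\<close> is deleted there and, along \<open>\<approx>\<close>, in \<open>F\<close>; it is
  put back around the part obtained for the smaller instance, which costs no width.\<close>

lemma split_width:
  assumes "F \<approx> Bin (conn_of q) G1 G2" "well_named F"
  shows "\<exists>F1 F2. F1 \<approx> G1 \<and> F2 \<approx> G2 \<and> width F1 \<le> width F \<and> width F2 \<le> width F"
  using assms
proof (induction "size G1 + size G2" arbitrary: F G1 G2 rule: less_induct)
  case less
  let ?G = "Bin (conn_of q) G1 G2"
  have wn: "well_named ?G"
    using less.prems acop_eq_well_named by blast
  show ?case
  proof (cases "essential q F")
    case True
    then show ?thesis
      using less.prems essential_split_width by blast
  next
    case False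
    then have "\<not> essential q ?G"
      using less.prems essential_acop_eq by blast
    with wn consider "\<not> essential q G1" "well_named G1" | "\<not> essential q G2" "well_named G2"
      by auto
    then show ?thesis
    proof cases
      case 1
      then obtain y H where H: "del q y G1 H" "y \<notin> free H"
        by (rule not_essentialE)
      have "y \<notin> free G2"
        using del_bound[OF H(1)] wn by auto
      have "del q y ?G (Bin (conn_of q) H G2)"
        using H by (auto intro: del.intros)
      then obtain F' where F': "del q y F F'" "F' \<approx> Bin (conn_of q) H G2"
        using del_acop_eq less.prems by blast
      then have "y \<notin> free F'"
        using H \<open>y \<notin> free G2\<close> acop_eq_free[OF F'(2)] by auto
      then have le: "width F' \<le> width F"
        using F' less.prems width_del by blast
      have "size H < size G1" "well_named F'"
        using H 1 F' less.prems del_facts by blast+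
      with less.hyps[of H G2 F'] F'(2) obtain F1 F2 where
        "F1 \<approx> H" "F2 \<approx> G2" "width F1 \<le> width F'" "width F2 \<le> width F'"
        by auto
      moreover have "G1 \<approx> Quant q y H"
        using H 1 del_acop_eq_Quant by blast
      ultimately have "Quant q y F1 \<approx> G1" "F2 \<approx> G2" "width (Quant q y F1) \<le> width F" "width F2 \<le> width F"
        using le by (auto intro: acop_eq_Quant acop_eq_sym rtranclp_trans[of acop])
      then show ?thesis by blast
    next
      case 2
      then obtain y H where H: "del q y G2 H" "y \<notin> free H"
        by (rule not_essentialE)
      have "y \<notin> free G1"
        using del_bound[OF H(1)] wn by auto
      have "del q y ?G (Bin (conn_of q) G1 H)"
        using H by (auto intro: del.intros)
      then obtain F' where F': "del q y F F'" "F' \<approx> Bin (conn_of q) G1 H"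
        using del_acop_eq less.prems by blast
      then have "y \<notin> free F'"
        using H \<open>y \<notin> free G1\<close> acop_eq_free[OF F'(2)] by auto
      then have le: "width F' \<le> width F"
        using F' less.prems width_del by blast
      have "size H < size G2" "well_named F'"
        using H 2 F' less.prems del_facts by blast+
      with less.hyps[of G1 H F'] F'(2) obtain F1 F2 where
        "F1 \<approx> G1" "F2 \<approx> H" "width F1 \<le> width F'" "width F2 \<le> width F'"
        by auto
      moreover have "G2 \<approx> Quant q y H"
        using H 2 del_acop_eq_Quant by blast
      ultimately have "F1 \<approx> G1" "Quant q y F2 \<approx> G2" "width F1 \<le> width F" "width (Quant q y F2) \<le> width F"
        using le by (auto intro: acop_eq_Quant acop_eq_sym rtranclp_trans[of acop])
      then show ?thesis by blast
    qed
  qed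
qed

section \<open>Inserting quantifiers below a region\<close>

text \<open>In \<open>here\<close> the condition on \<open>c\<close> says that \<open>F\<close> is
  not itself part of the region but a child of it, as equivalent formulas agree in
  \<open>root_conn\<close>. The other side conditions confine the descent to a child that holds all
  free occurrences of \<open>x\<close>.\<close>

inductive ins :: "quant \<Rightarrow> var \<Rightarrow> 'r fo \<Rightarrow> 'r fo \<Rightarrow> bool" for q x where
  here: "F \<approx> Bin c F1 F2 \<Longrightarrow> c \<noteq> conn_of q \<Longrightarrow>
    ins q x F (Bin c (Quant q x F1) (Quant q x F2))"
| left: "ins q x A A' \<Longrightarrow> x \<notin> free B \<Longrightarrow> ins q x (Bin (conn_of q) A B) (Bin (conn_of q) A' B)"
| right: "ins q x B B' \<Longrightarrow> x \<notin> free A \<Longrightarrow> ins q x (Bin (conn_of q) A B) (Bin (conn_of q) A B')"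
| quant: "ins q x A A' \<Longrightarrow> y \<noteq> x \<Longrightarrow> ins q x (Quant q y A) (Quant q y A')"

lemma ins_free: "ins q x F F' \<Longrightarrow> free F' = free F - {x}"
  by (induction rule: ins.induct) (auto dest: acop_eq_free)

lemma ins_BinE:
  assumes "ins q x (Bin (conn_of q) A B) F'"
  obtains A' where "F' = Bin (conn_of q) A' B" "ins q x A A'" "x \<notin> free B"
  | B' where "F' = Bin (conn_of q) A B'" "ins q x B B'" "x \<notin> free A"
  using assms by (cases rule: ins.cases) (auto intro: that dest!: acop_eq_root_conn)

lemma ins_QuantE:
  assumes "ins q x (Quant q y A) F'"
  obtains A' where "F' = Quant q y A'" "ins q x A A'" "y \<noteq> x"
  using assms by (cases rule: ins.cases) (auto intro: that dest!: acop_eq_root_conn)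

text \<open>Only \<open>ins.here\<close> applies to such a root, and that rule accepts every
  equivalent formula.\<close>

lemma ins_acop_other:
  assumes "acop F G" "root_conn G \<noteq> Some (conn_of q)" "ins q x G G'"
  shows "\<exists>F'. ins q x F F' \<and> F' \<approx> G'"
  using assms(3)
proof (cases rule: ins.cases)
  case (here c F1 F2)
  then have "F \<approx> Bin c F1 F2"
    using assms(1) by (meson converse_rtranclp_into_rtranclp)
  with here show ?thesis
    by (auto intro: ins.here)
qed (use assms in auto)

text \<open>Insertion and rearrangement act on different levels: the rules move the children of the
  region about, while insertion changes the inside of one child and drops at most \<open>x\<close>
  from its free variables.\<close>

lemma ins_acop:
  "acop F G \<Longrightarrow> well_named F \<Longrightarrow> x \<notin> bound F \<Longrightarrow> ins q x G G' \<Longrightarrow>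
    \<exists>F'. ins q x F F' \<and> F' \<approx> G'"
proof (induction arbitrary: G' rule: acop.induct)
  case (assocl c A B C)
  show ?case
  proof (cases "c = conn_of q")
    case [simp]: True
    from assocl(3) show ?thesis
      by (fastforce elim!: ins_BinE intro: ins.left ins.right acop_intros)
  qed (use assocl in \<open>auto intro: ins_acop_other acop.intros\<close>)
next
  case (assocr c A B C)
  show ?case
  proof (cases "c = conn_of q")
    case [simp]: True
    from assocr(3) show ?thesis
      by (fastforce elim!: ins_BinE intro: ins.left ins.right acop_intros)
  qed (use assocr in \<open>auto intro: ins_acop_other acop.intros\<close>)
next
  case (comm c A B)
  show ?case
  proof (cases "c = conn_of q")
    case [simp]: True
    from comm(3) show ?thesis
      by (fastforce elim!: ins_BinE intro: ins.left ins.right acop_intros)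
  qed (use comm in \<open>auto intro: ins_acop_other acop.intros\<close>)
next
  case (swap p u v A)
  show ?case
  proof (cases "p = q")
    case [simp]: True
    from swap(3) show ?thesis
      by (fastforce elim!: ins_QuantE intro: ins.quant acop_intros)
  qed (use swap in \<open>auto intro: ins_acop_other acop.intros\<close>)
next
  case (push u B p A)
  show ?case
  proof (cases "p = q")
    case [simp]: True
    have fresh: "u \<notin> free B'" if "ins q x B B'" for B'
      using ins_free[OF that] push.hyps by auto
    \<comment> \<open>In \<open>F\<close> the insertion has to cross the binder of \<open>u\<close>,
      which must not capture \<open>x\<close>; this is where \<open>x \<notin> bound F\<close>
      enters.\<close>
    have "u \<noteq> x"
      using push.prems by auto
    from push(4) have "ins q x (Bin (conn_of q) (Quant q u A) B) G'"
      by simp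
    then show ?thesis
    proof (cases rule: ins_BinE)
      case (1 X)
      from 1(2) obtain A' where A': "X = Quant q u A'" "ins q x A A'"
        by (rule ins_QuantE)
      have "ins q x (Quant q u (Bin (conn_of q) A B)) (Quant q u (Bin (conn_of q) A' B))"
        using A' 1 \<open>u \<noteq> x\<close> by (intro ins.intros)
      with A' 1 push.hyps show ?thesis
        unfolding True using acop_intros(5) by blast
    next
      case (2 B')
      have "ins q x (Quant q u (Bin (conn_of q) A B)) (Quant q u (Bin (conn_of q) A B'))"
        using 2 \<open>u \<noteq> x\<close> by (intro ins.intros) auto
      with 2 fresh show ?thesis
        unfolding True using acop_intros(5) by blast
    qed
  qed (use push in \<open>auto intro: ins_acop_other acop.intros\<close>)
next
  case (pull u B p A)
  show ?case
  proof (cases "p = q")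
    case [simp]: True
    have fresh: "u \<notin> free B'" if "ins q x B B'" for B'
      using ins_free[OF that] pull.hyps by auto
    from pull(4) obtain X where X: "G' = Quant q u X" "ins q x (Bin (conn_of q) A B) X" "u \<noteq> x"
      unfolding True by (rule ins_QuantE)
    from X(2) show ?thesis
    proof (cases rule: ins_BinE)
      case (1 A')
      have "ins q x (Bin (conn_of q) (Quant q u A) B) (Bin (conn_of q) (Quant q u A') B)"
        using 1 X by (intro ins.intros)
      with 1 X pull.hyps show ?thesis
        unfolding True using acop_intros(6) by blast
    next
      case (2 B')
      have "ins q x (Bin (conn_of q) (Quant q u A) B) (Bin (conn_of q) (Quant q u A) B')"
        using 2 by (intro ins.intros) auto
      with 2 X fresh show ?thesis
        unfolding True using acop_intros(6) by blast
    qed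
  qed (use pull in \<open>auto intro: ins_acop_other acop.intros\<close>)
next
  case (neg A B)
  from ins_acop_other[OF acop.neg[OF neg.hyps] _ neg.prems(3)] show ?case
    by simp
next
  case (left A B c C)
  show ?case
  proof (cases "c = conn_of q")
    case [simp]: True
    from left.prems(3) have "ins q x (Bin (conn_of q) B C) G'"
      by simp
    then show ?thesis
    proof (cases rule: ins_BinE)
      case (1 B')
      with left.IH[OF _ _ 1(2)] left.prems obtain A' where "ins q x A A'" "A' \<approx> B'"
        by auto
      with 1 show ?thesis
        unfolding True using ins.left acop_eq_left by blast
    next
      case (2 C')
      then show ?thesis
        unfolding True using left.hyps acop_free[OF left.hyps] ins.right acop_intros(8) by metis
    qed
  qed (use left.hyps left.prems(3) in \<open>auto intro!: ins_acop_other acop.left\<close>)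
next
  case (right A B c C)
  show ?case
  proof (cases "c = conn_of q")
    case [simp]: True
    from right.prems(3) have "ins q x (Bin (conn_of q) C B) G'"
      by simp
    then show ?thesis
    proof (cases rule: ins_BinE)
      case (1 C')
      then show ?thesis
        unfolding True using right.hyps acop_free[OF right.hyps] ins.left acop_intros(9) by metis
    next
      case (2 B')
      with right.IH[OF _ _ 2(2)] right.prems obtain A' where "ins q x A A'" "A' \<approx> B'"
        by auto
      with 2 show ?thesis
        unfolding True using ins.right acop_eq_right by blast
    qed
  qed (use right.hyps right.prems(3) in \<open>auto intro!: ins_acop_other acop.right\<close>)
next
  case (quant A B p y)
  show ?case
  proof (cases "p = q")
    case [simp]: True
    from quant.prems(3) obtain B' where B': "G' = Quant q y B'" "ins q x B B'" "y \<noteq> x"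
      unfolding True by (rule ins_QuantE)
    moreover from quant.IH[OF _ _ B'(2)] quant.prems obtain A' where "ins q x A A'" "A' \<approx> B'"
      by auto
    ultimately show ?thesis
      unfolding True using ins.quant acop_eq_Quant by blast
  qed (use quant.hyps quant.prems(3) in \<open>auto intro!: ins_acop_other acop.quant\<close>)
qed

lemma ins_acop_eq:
  "F \<approx> G \<Longrightarrow> well_named F \<Longrightarrow> x \<notin> bound F \<Longrightarrow> ins q x G G' \<Longrightarrow>
    \<exists>F'. ins q x F F' \<and> F' \<approx> G'"
proof (induction arbitrary: G' rule: rtranclp_induct)
  case (step G H)
  have "bound F = bound G"
    using step.hyps(1) by (induction rule: rtranclp_induct) (auto dest: acop_bound)
  with step.hyps step.prems obtain G1 where "ins q x G G1" "G1 \<approx> G'"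
    using ins_acop acop_eq_well_named by metis
  with step.IH step.prems show ?case
    by (meson rtranclp_trans)
qed blast

text \<open>The width that remains once \<open>x\<close>, exposed by the deletion of its quantifier, is bound again below
  the region: \<open>x\<close> is not counted at the inner nodes of the region.\<close>

fun region_width :: "quant \<Rightarrow> var \<Rightarrow> 'r fo \<Rightarrow> nat" where
  "region_width q x (Bin c A B) =
    (if c = conn_of q
     then max (card (free A \<union> free B - {x})) (max (region_width q x A) (region_width q x B))
     else width (Bin c A B))"
| "region_width q x (Quant p y A) = (if p = q then region_width q x A else width A)"
| "region_width q x F = width F"

lemma region_width_le: "region_width q x F \<le> width F"
proof (induction F)
  case (Bin c A B)
  have "card (free A \<union> free B - {x}) \<le> card (free A \<union> free B)"
    by (auto intro: card_mono)
  with Bin show ?case by auto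
qed auto

lemma region_width_fresh: "x \<notin> free F \<Longrightarrow> x \<notin> bound F \<Longrightarrow> region_width q x F = width F"
  by (induction F) auto

text \<open>Above the deleted binder, the sets of free variables grow by at most \<open>x\<close>,
  and there \<open>region_width\<close> discounts \<open>x\<close>.\<close>

lemma region_width_del: "del q x F F' \<Longrightarrow> well_named F \<Longrightarrow> region_width q x F' \<le> width F"
proof (induction rule: del.induct)
  case (here A)
  then show ?case by (simp add: region_width_le)
next
  case (left A A' B)
  then have "free A' \<union> free B - {x} \<subseteq> free A \<union> free B"
    using del_facts[of q x A A'] by auto
  then have "card (free A' \<union> free B - {x}) \<le> card (free A \<union> free B)"
    by (auto intro: card_mono)
  with left region_width_le[of q x B] show ?case by auto
next
  case (right B B' A)
  then have "free A \<union> free B' - {x} \<subseteq> free A \<union> free B"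
    using del_facts[of q x B B'] by auto
  then have "card (free A \<union> free B' - {x}) \<le> card (free A \<union> free B)"
    by (auto intro: card_mono)
  with right region_width_le[of q x A] show ?case by auto
next
  case (quant A A' y)
  then show ?case by auto
qed

lemma region_width_other:
  "root_conn F \<noteq> Some (conn_of q) \<Longrightarrow> region_width q x F = width F"
  by (cases F) auto

text \<open>On the path to the chosen child the inserted quantifiers bind \<open>x\<close> again, so
  inner nodes have just the variables that \<open>region_width\<close> counts, and \<open>x\<close>
  does not occur in the siblings off the path. At the child, \<open>split_width\<close> supplies
  halves no wider than the child.\<close>

lemma ins_width:
  "ins q x F F' \<Longrightarrow> well_named F \<Longrightarrow> x \<notin> bound F \<Longrightarrow>
    \<exists>F''. F'' \<approx> F' \<and> width F'' \<le> region_width q x F"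
proof (induction rule: ins.induct)
  case (here F c F1 F2)
  \<comment> \<open>The child belongs to a region of the other kind, so \<open>split_width\<close>
    is used with the quantifier belonging to \<open>c\<close>.\<close>
  have c: "c = conn_of (if c = And then Ex else All)"
    by (cases c) auto
  from here c split_width obtain G1 G2 where G: "G1 \<approx> F1" "G2 \<approx> F2"
    "width G1 \<le> width F" "width G2 \<le> width F"
    by metis
  have "free G1 \<union> free G2 = free F"
    using here G by (auto dest!: acop_eq_free)
  then have "card (free G1 - {x} \<union> (free G2 - {x})) \<le> card (free F)"
    by (intro card_mono) auto
  also have "\<dots> \<le> width F"
    by (rule card_free_le_width)
  finally have "width (Bin c (Quant q x G1) (Quant q x G2)) \<le> width F"
    using G by simp
  moreover have "region_width q x F = width F"
    using here by (intro region_width_other) (auto dest: acop_eq_root_conn)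
  moreover have "Bin c (Quant q x G1) (Quant q x G2) \<approx> Bin c (Quant q x F1) (Quant q x F2)"
    using G by (intro acop_eq_Bin acop_eq_Quant)
  ultimately show ?case by metis
next
  case (left A A' B)
  then obtain A'' where A'': "A'' \<approx> A'" "width A'' \<le> region_width q x A"
    by auto
  have "free A'' = free A - {x}"
    using A'' left by (auto dest!: acop_eq_free ins_free)
  then have "card (free A'' \<union> free B) = card (free A \<union> free B - {x})"
    using left.hyps by (intro arg_cong[where f = card]) auto
  moreover have "region_width q x B = width B"
    using left by (intro region_width_fresh) auto
  ultimately have "width (Bin (conn_of q) A'' B) \<le> region_width q x (Bin (conn_of q) A B)"
    using A'' by auto
  then show ?case
    using A'' acop_eq_left by blast
next
  case (right B B' A)
  then obtain B'' where B'': "B'' \<approx> B'" "width B'' \<le> region_width q x B"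
    by auto
  have "free B'' = free B - {x}"
    using B'' right by (auto dest!: acop_eq_free ins_free)
  then have "card (free A \<union> free B'') = card (free A \<union> free B - {x})"
    using right.hyps by (intro arg_cong[where f = card]) auto
  moreover have "region_width q x A = width A"
    using right by (intro region_width_fresh) auto
  ultimately have "width (Bin (conn_of q) A B'') \<le> region_width q x (Bin (conn_of q) A B)"
    using B'' by auto
  then show ?case
    using B'' acop_eq_right by blast
next
  case (quant A A' y)
  then obtain A'' where "A'' \<approx> A'" "width A'' \<le> region_width q x A"
    by auto
  then have "Quant q y A'' \<approx> Quant q y A'" "width (Quant q y A'') \<le> region_width q x (Quant q y A)"
    by (auto intro: acop_eq_Quant)
  then show ?case by blast
qed

section \<open>Generalized splitting and removal steps\<close>

definition region_step :: "quant \<Rightarrow> var \<Rightarrow> 'r fo \<Rightarrow> 'r fo \<Rightarrow> bool" where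
  "region_step q x F F' \<longleftrightarrow>
    (\<exists>F1. del q x F F1 \<and> (x \<notin> free F1 \<and> F' = F1 \<or> ins q x F1 F'))"

text \<open>The deletion is transported first. It removes \<open>x\<close> from the bound variables,
  as transporting the insertion requires.\<close>

lemma region_step_acop:
  assumes "acop F G" "well_named F" "region_step q x G G'"
  shows "\<exists>F'. region_step q x F F' \<and> F' \<approx> G'"
proof -
  from assms(3) obtain G1 where G1: "del q x G G1"
    and "x \<notin> free G1 \<and> G' = G1 \<or> ins q x G1 G'"
    by (auto simp: region_step_def)
  moreover from del_acop[OF assms(1,2) G1] obtain F1 where F1: "del q x F F1" "F1 \<approx> G1"
    by blast
  moreover have "well_named F1" "x \<notin> bound F1"
    using del_facts[OF F1(1) assms(2)] by auto
  ultimately show ?thesis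
    unfolding region_step_def by (metis acop_eq_free ins_acop_eq)
qed

lemma region_step_free: "region_step q x F F' \<Longrightarrow> well_named F \<Longrightarrow> free F' = free F"
  by (auto simp: region_step_def dest!: ins_free del_facts)

text \<open>The formula between deletion and insertion may be wider than \<open>F\<close>; measured
  by \<open>region_width\<close> it is not, and this is the bound that survives the
  insertion.\<close>

lemma region_step_width:
  assumes "region_step q x F F'" "well_named F"
  shows "\<exists>F''. F'' \<approx> F' \<and> width F'' \<le> width F"
proof -
  from assms(1) obtain F1 where F1: "del q x F F1"
    and cases: "x \<notin> free F1 \<and> F' = F1 \<or> ins q x F1 F'"
    by (auto simp: region_step_def)
  from cases show ?thesis
  proof
    assume "x \<notin> free F1 \<and> F' = F1"
    with F1 assms show ?thesis
      using width_del by blast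
  next
    assume "ins q x F1 F'"
    moreover have "well_named F1" "x \<notin> bound F1"
      using del_facts[OF F1 assms(2)] by auto
    ultimately obtain F'' where "F'' \<approx> F'" "width F'' \<le> region_width q x F1"
      using ins_width by blast
    with region_width_del[OF F1 assms(2)] show ?thesis
      using le_trans by blast
  qed
qed

lemma region_step_left:
  "region_step q x A A' \<Longrightarrow> well_named (Bin (conn_of q) A B) \<Longrightarrow>
    region_step q x (Bin (conn_of q) A B) (Bin (conn_of q) A' B)"
  unfolding region_step_def
  by (force dest: del_bound intro: del.left ins.left)

lemma region_step_right:
  "region_step q x B B' \<Longrightarrow> well_named (Bin (conn_of q) A B) \<Longrightarrow>
    region_step q x (Bin (conn_of q) A B) (Bin (conn_of q) A B')"
  unfolding region_step_def
  by (force dest: del_bound intro: del.right ins.right)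

lemma region_step_quant:
  "region_step q x A A' \<Longrightarrow> well_named (Quant q y A) \<Longrightarrow>
    region_step q x (Quant q y A) (Quant q y A')"
  unfolding region_step_def
  by (force dest: del_bound intro: del.quant ins.quant)

lemma region_step_BinD: "region_step q x (Bin c A B) F' \<Longrightarrow> c = conn_of q"
  by (auto simp: region_step_def elim: del_BinE)

lemma region_step_QuantD: "region_step q x (Quant p y A) F' \<Longrightarrow> p = q"
  by (auto simp: region_step_def elim: del_QuantE)

section \<open>Generalized steps in arbitrary contexts\<close>

inductive reduce :: "'r fo \<Rightarrow> 'r fo \<Rightarrow> bool" where
  region: "region_step q x F F' \<Longrightarrow> reduce F F'"
| neg: "reduce A A' \<Longrightarrow> reduce (Neg A) (Neg A')"
| left: "reduce A A' \<Longrightarrow> reduce (Bin c A B) (Bin c A' B)"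
| right: "reduce B B' \<Longrightarrow> reduce (Bin c A B) (Bin c A B')"
| quant: "reduce A A' \<Longrightarrow> reduce (Quant q y A) (Quant q y A')"

lemma reduce_free: "reduce F F' \<Longrightarrow> well_named F \<Longrightarrow> free F' = free F"
  by (induction rule: reduce.induct) (auto simp: region_step_free)

lemma reduce_width:
  "reduce F F' \<Longrightarrow> well_named F \<Longrightarrow> \<exists>F''. F'' \<approx> F' \<and> width F'' \<le> width F"
proof (induction rule: reduce.induct)
  case (region q x F F')
  then show ?case by (rule region_step_width)
next
  case (neg A A')
  then obtain A'' where "A'' \<approx> A'" "width A'' \<le> width A" by auto
  then show ?case
    using acop_eq_Neg by (intro exI[of _ "Neg A''"]) auto
next
  case (left A A' c B)
  then obtain A'' where "A'' \<approx> A'" "width A'' \<le> width A" by auto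
  moreover from this have "free A'' = free A"
    using left acop_eq_free reduce_free by (metis well_named.simps(3))
  ultimately show ?case
    using acop_eq_left by (intro exI[of _ "Bin c A'' B"]) auto
next
  case (right B B' c A)
  then obtain B'' where "B'' \<approx> B'" "width B'' \<le> width B" by auto
  moreover from this have "free B'' = free B"
    using right acop_eq_free reduce_free by (metis well_named.simps(3))
  ultimately show ?case
    using acop_eq_right by (intro exI[of _ "Bin c A B''"]) auto
next
  case (quant A A' q y)
  then obtain A'' where "A'' \<approx> A'" "width A'' \<le> width A" by auto
  then show ?case
    using acop_eq_Quant by (intro exI[of _ "Quant q y A''"]) auto
qed

lemma reduce_Bin_cases:
  assumes "reduce (Bin c A B) F'"
  obtains q x where "region_step q x (Bin c A B) F'"
  | A' where "F' = Bin c A' B" "reduce A A'"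
  | B' where "F' = Bin c A B'" "reduce B B'"
  using assms by (cases rule: reduce.cases) (auto intro: that)

lemma reduce_Quant_cases:
  assumes "reduce (Quant p y A) F'"
  obtains q x where "region_step q x (Quant p y A) F'"
  | A' where "F' = Quant p y A'" "reduce A A'"
  using assms by (cases rule: reduce.cases) (auto intro: that)

text \<open>A region step at the inner node is also one at the outer node, since both belong to the
  same region. What remains lies within \<open>A\<close>, \<open>B\<close> or \<open>C\<close>. The
  next four lemmas treat the other redex shapes alike.\<close>

lemma reduce_Bin_Bin_cases:
  assumes "reduce (Bin c (Bin c A B) C) F'" "well_named (Bin c (Bin c A B) C)"
  obtains q x where "region_step q x (Bin c (Bin c A B) C) F'"
  | A' where "F' = Bin c (Bin c A' B) C" "reduce A A'"
  | B' where "F' = Bin c (Bin c A B') C" "reduce B B'"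
  | C' where "F' = Bin c (Bin c A B) C'" "reduce C C'"
  using assms(1)
proof (cases rule: reduce_Bin_cases)
  case (2 X)
  from 2(2) show thesis
  proof (cases rule: reduce_Bin_cases)
    case (1 q x)
    then show thesis
      using 2(1) assms(2) region_step_BinD region_step_left that(1) by blast
  qed (use 2 that in auto)
qed (use that in auto)

lemma reduce_Bin_Bin_cases':
  assumes "reduce (Bin c A (Bin c B C)) F'" "well_named (Bin c A (Bin c B C))"
  obtains q x where "region_step q x (Bin c A (Bin c B C)) F'"
  | A' where "F' = Bin c A' (Bin c B C)" "reduce A A'"
  | B' where "F' = Bin c A (Bin c B' C)" "reduce B B'"
  | C' where "F' = Bin c A (Bin c B C')" "reduce C C'"
  using assms(1)
proof (cases rule: reduce_Bin_cases)
  case (3 X)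
  from 3(2) show thesis
  proof (cases rule: reduce_Bin_cases)
    case (1 q x)
    then show thesis
      using 3(1) assms(2) region_step_BinD region_step_right that(1) by blast
  qed (use 3 that in auto)
qed (use that in auto)

lemma reduce_Quant_Quant_cases:
  assumes "reduce (Quant p y (Quant p z A)) F'" "well_named (Quant p y (Quant p z A))"
  obtains q x where "region_step q x (Quant p y (Quant p z A)) F'"
  | A' where "F' = Quant p y (Quant p z A')" "reduce A A'"
  using assms(1)
proof (cases rule: reduce_Quant_cases)
  case (2 X)
  from 2(2) show thesis
  proof (cases rule: reduce_Quant_cases)
    case (1 q x)
    then show thesis
      using 2(1) assms(2) region_step_QuantD region_step_quant that(1) by blast
  qed (use 2 that in auto)
qed (use that in auto)

lemma reduce_Bin_Quant_cases:
  assumes "reduce (Bin (conn_of p) (Quant p y A) B) F'" "well_named (Bin (conn_of p) (Quant p y A) B)"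
  obtains q x where "region_step q x (Bin (conn_of p) (Quant p y A) B) F'"
  | A' where "F' = Bin (conn_of p) (Quant p y A') B" "reduce A A'"
  | B' where "F' = Bin (conn_of p) (Quant p y A) B'" "reduce B B'"
  using assms(1)
proof (cases rule: reduce_Bin_cases)
  case (2 X)
  from 2(2) show thesis
  proof (cases rule: reduce_Quant_cases)
    case (1 q x)
    then show thesis
      using 2(1) assms(2) region_step_QuantD region_step_left that(1) by blast
  qed (use 2 that in auto)
qed (use that in auto)

lemma reduce_Quant_Bin_cases:
  assumes "reduce (Quant p y (Bin (conn_of p) A B)) F'" "well_named (Quant p y (Bin (conn_of p) A B))"
  obtains q x where "region_step q x (Quant p y (Bin (conn_of p) A B)) F'"
  | A' where "F' = Quant p y (Bin (conn_of p) A' B)" "reduce A A'"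
  | B' where "F' = Quant p y (Bin (conn_of p) A B')" "reduce B B'"
  using assms(1)
proof (cases rule: reduce_Quant_cases)
  case (2 X)
  from 2(2) show thesis
  proof (cases rule: reduce_Bin_cases)
    case (1 q x)
    then have "p = q"
      by (auto dest: region_step_BinD)
    with 1 show thesis
      using 2(1) assms(2) region_step_quant that(1) by blast
  qed (use 2 that in auto)
qed (use that in auto)

text \<open>A step in \<open>G\<close> is either a region step at the root, which
  \<open>region_step_acop\<close> transports, or lies in a subformula that the rule moves as a
  whole. In the latter case \<open>reduce\<close> keeps the free variables of that subformula, so
  the rule still applies.\<close>

lemma reduce_acop:
  "acop F G \<Longrightarrow> well_named F \<Longrightarrow> reduce G G' \<Longrightarrow> \<exists>F'. reduce F F' \<and> F' \<approx> G'"
proof (induction arbitrary: G' rule: acop.induct)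
  case (assocl c A B C)
  have step: "acop (Bin c A (Bin c B C)) (Bin c (Bin c A B) C)"
    by (rule acop.intros)
  from assocl(2) acop_well_named[OF step assocl(1)] show ?case
    by (cases rule: reduce_Bin_Bin_cases)
      (blast dest: region_step_acop[OF step assocl(1)]
        intro: reduce.region reduce.left reduce.right reduce.quant acop_intros(1))+
next
  case (assocr c A B C)
  have step: "acop (Bin c (Bin c A B) C) (Bin c A (Bin c B C))"
    by (rule acop.intros)
  from assocr(2) acop_well_named[OF step assocr(1)] show ?case
    by (cases rule: reduce_Bin_Bin_cases')
      (blast dest: region_step_acop[OF step assocr(1)]
        intro: reduce.region reduce.left reduce.right reduce.quant acop_intros(2))+
next
  case (comm c A B)
  have step: "acop (Bin c A B) (Bin c B A)"
    by (rule acop.intros)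
  from comm(2) show ?case
    by (cases rule: reduce_Bin_cases)
      (blast dest: region_step_acop[OF step comm(1)]
        intro: reduce.region reduce.left reduce.right reduce.quant acop_intros(3))+
next
  case (swap p y z A)
  have step: "acop (Quant p y (Quant p z A)) (Quant p z (Quant p y A))"
    by (rule acop.intros)
  from swap(2) acop_well_named[OF step swap(1)] show ?case
    by (cases rule: reduce_Quant_Quant_cases)
      (blast dest: region_step_acop[OF step swap(1)]
        intro: reduce.region reduce.left reduce.right reduce.quant acop_intros(4))+
next
  case (push y B p A)
  have step: "acop (Quant p y (Bin (conn_of p) A B)) (Bin (conn_of p) (Quant p y A) B)"
    using push.hyps by (rule acop.intros)
  have "y \<notin> free B'" if "reduce B B'" for B'
    using reduce_free[OF that] push.hyps push.prems by auto
  with push(3) acop_well_named[OF step push(2)] show ?case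
    using push.hyps
    by (cases rule: reduce_Bin_Quant_cases)
      (blast dest: region_step_acop[OF step push(2)]
        intro: reduce.region reduce.left reduce.right reduce.quant acop_intros(5))+
next
  case (pull y B p A)
  have step: "acop (Bin (conn_of p) (Quant p y A) B) (Quant p y (Bin (conn_of p) A B))"
    using pull.hyps by (rule acop.intros)
  have "y \<notin> free B'" if "reduce B B'" for B'
    using reduce_free[OF that] pull.hyps pull.prems by auto
  with pull(3) acop_well_named[OF step pull(2)] show ?case
    using pull.hyps
    by (cases rule: reduce_Quant_Bin_cases)
      (blast dest: region_step_acop[OF step pull(2)]
        intro: reduce.region reduce.left reduce.right reduce.quant acop_intros(6))+
next
  case (neg A B)
  from neg.prems(2) show ?case
  proof (cases rule: reduce.cases)
    case (region q x)
    then show ?thesis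
      by (auto simp: region_step_def elim: del_NegE)
  next
    case (neg B')
    with neg.IH[of B'] neg.prems show ?thesis
      by (auto intro: reduce.neg acop_eq_Neg)
  qed
next
  case (left A B c C)
  have step: "acop (Bin c A C) (Bin c B C)"
    using left.hyps by (rule acop.intros)
  from left.prems(2) show ?case
  proof (cases rule: reduce_Bin_cases)
    case (1 q x)
    then show ?thesis
      using region_step_acop[OF step left.prems(1)] reduce.region by blast
  next
    case (2 B')
    with left.IH[of B'] left.prems(1) show ?thesis
      by (auto intro: reduce.left acop_eq_left)
  next
    case (3 C')
    then show ?thesis
      using reduce.right acop_intros(8) left.hyps by blast
  qed
next
  case (right A B c C)
  have step: "acop (Bin c C A) (Bin c C B)"
    using right.hyps by (rule acop.intros)
  from right.prems(2) show ?case
  proof (cases rule: reduce_Bin_cases)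
    case (1 q x)
    then show ?thesis
      using region_step_acop[OF step right.prems(1)] reduce.region by blast
  next
    case (2 C')
    then show ?thesis
      using reduce.left acop_intros(9) right.hyps by blast
  next
    case (3 B')
    with right.IH[of B'] right.prems(1) show ?thesis
      by (auto intro: reduce.right acop_eq_right)
  qed
next
  case (quant A B p y)
  have step: "acop (Quant p y A) (Quant p y B)"
    using quant.hyps by (rule acop.intros)
  from quant.prems(2) show ?case
  proof (cases rule: reduce_Quant_cases)
    case (1 q x)
    then show ?thesis
      using region_step_acop[OF step quant.prems(1)] reduce.region by blast
  next
    case (2 B')
    with quant.IH[of B'] quant.prems(1) show ?thesis
      by (auto intro: reduce.quant acop_eq_Quant)
  qed
qed

lemma reduce_acop_eq:
  "F \<approx> G \<Longrightarrow> well_named F \<Longrightarrow> reduce G G' \<Longrightarrow> \<exists>F'. reduce F F' \<and> F' \<approx> G'"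
proof (induction arbitrary: G' rule: rtranclp_induct)
  case (step G H)
  from step.hyps step.prems obtain G1 where "reduce G G1" "G1 \<approx> G'"
    using reduce_acop acop_eq_well_named by blast
  with step.IH step.prems show ?case
    by (meson rtranclp_trans)
qed blast

text \<open>The quantifier is deleted at the redex root. For \<open>Rule_Sdown\<close>,
  \<open>ins.here\<close> then applies at once, because that rule distributes the quantifier over
  the connective of the other kind.\<close>

lemma rewr_reduce: "rewr {Rule_Sdown, Rule_M} F G \<Longrightarrow> reduce F G"
proof (induction rule: rewr.induct)
  case (root R F G)
  then have "rewr_root R F G" "R = Rule_Sdown \<or> R = Rule_M" by auto
  then show ?case
  proof (cases rule: rewr_root.cases)
    case (split_Ex x F1 F2)
    then show ?thesis
      by (auto simp: region_step_def intro!: reduce.region[of Ex x] exI[of _ "Bin Or F1 F2"]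
          del.here ins.here)
  next
    case (split_All x F1 F2)
    then show ?thesis
      by (auto simp: region_step_def intro!: reduce.region[of All x] exI[of _ "Bin And F1 F2"]
          del.here ins.here)
  next
    case (remove x q)
    then show ?thesis
      by (auto simp: region_step_def intro!: reduce.region[of q x] exI[of _ G] del.here)
  qed auto
qed (auto intro: reduce.intros)

section \<open>Renaming of bound variables\<close>

definition bind_rel :: "(var \<Rightarrow> var \<Rightarrow> bool) \<Rightarrow> var \<Rightarrow> var \<Rightarrow> var \<Rightarrow> var \<Rightarrow> bool" where
  "bind_rel \<rho> x y a b \<longleftrightarrow> (a = x \<and> b = y \<or> a \<noteq> x \<and> b \<noteq> y \<and> \<rho> a b)"

text \<open>Alpha-equivalence relative to a correspondence \<open>\<rho>\<close> between the free
  variables of the two sides, so that bodies under differently named binders can be compared without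
  substitution. Alpha-equivalence proper is \<open>alpha (=)\<close>.\<close>

fun alpha :: "(var \<Rightarrow> var \<Rightarrow> bool) \<Rightarrow> 'r fo \<Rightarrow> 'r fo \<Rightarrow> bool" where
  "alpha \<rho> (Atom r xs) G \<longleftrightarrow> (\<exists>ys. G = Atom r ys \<and> list_all2 \<rho> xs ys)"
| "alpha \<rho> (Neg A) G \<longleftrightarrow> (\<exists>B. G = Neg B \<and> alpha \<rho> A B)"
| "alpha \<rho> (Bin c A B) G \<longleftrightarrow> (\<exists>A' B'. G = Bin c A' B' \<and> alpha \<rho> A A' \<and> alpha \<rho> B B')"
| "alpha \<rho> (Quant q x A) G \<longleftrightarrow> (\<exists>y A'. G = Quant q y A' \<and> alpha (bind_rel \<rho> x y) A A')"

lemma alpha_mono: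
  "alpha \<rho> F G \<Longrightarrow> (\<And>a b. a \<in> free F \<Longrightarrow> b \<in> free G \<Longrightarrow> \<rho> a b \<Longrightarrow> \<sigma> a b) \<Longrightarrow> alpha \<sigma> F G"
proof (induction F arbitrary: \<rho> \<sigma> G)
  case (Atom r xs)
  then show ?case
    by (auto simp: list_all2_conv_all_nth)
next
  case (Quant q x A)
  then obtain y B where B: "G = Quant q y B" "alpha (bind_rel \<rho> x y) A B"
    by auto
  have "alpha (bind_rel \<sigma> x y) A B"
    using B(2) by (rule Quant.IH) (use Quant.prems B in \<open>auto simp: bind_rel_def\<close>)
  then show ?case
    using B by auto
qed fastforce+

lemma alpha_refl: "(\<And>a. a \<in> free F \<Longrightarrow> \<rho> a a) \<Longrightarrow> alpha \<rho> F F"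
proof (induction F arbitrary: \<rho>)
  case (Atom r xs)
  then show ?case
    by (auto simp: list_all2_conv_all_nth)
next
  case (Quant q x A)
  have "alpha (bind_rel \<rho> x x) A A"
    by (rule Quant.IH) (use Quant.prems in \<open>auto simp: bind_rel_def\<close>)
  then show ?case by auto
qed auto

lemma alpha_sym: "alpha \<rho> F G \<Longrightarrow> alpha (\<lambda>a b. \<rho> b a) G F"
proof (induction F arbitrary: \<rho> G)
  case (Atom r xs)
  then show ?case
    by (auto simp: list_all2_conv_all_nth)
next
  case (Quant q x A)
  then obtain y B where B: "G = Quant q y B" "alpha (bind_rel \<rho> x y) A B"
    by auto
  have "(\<lambda>a b. bind_rel \<rho> x y b a) = bind_rel (\<lambda>a b. \<rho> b a) y x"
    by (auto simp: bind_rel_def fun_eq_iff)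
  with B(1) Quant.IH[OF B(2)] show ?case by auto
qed auto

lemma alpha_trans: "alpha \<rho> F G \<Longrightarrow> alpha \<sigma> G H \<Longrightarrow> alpha (\<rho> OO \<sigma>) F H"
proof (induction F arbitrary: \<rho> \<sigma> G H)
  case (Atom r xs)
  then obtain ys zs where "G = Atom r ys" "H = Atom r zs" "list_all2 \<rho> xs ys" "list_all2 \<sigma> ys zs"
    by auto
  moreover from this(3,4) have "list_all2 (\<rho> OO \<sigma>) xs zs"
    unfolding list.rel_compp by (rule relcomppI)
  ultimately show ?case by simp
next
  case (Quant q x A)
  then obtain y B z C where "G = Quant q y B" "H = Quant q z C"
    "alpha (bind_rel \<rho> x y) A B" "alpha (bind_rel \<sigma> y z) B C"
    by auto
  moreover from this have "alpha (bind_rel \<rho> x y OO bind_rel \<sigma> y z) A C"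
    using Quant.IH by blast
  \<comment> \<open>The variable \<open>y\<close> is matched with a binder in both relations or in
    neither, so the composition of the two extensions is contained in the extension of the
    composition.\<close>
  ultimately show ?case
    by (auto simp: bind_rel_def elim!: alpha_mono)
qed fastforce+

lemma alpha_eq_sym: "alpha (=) F G \<Longrightarrow> alpha (=) G F"
  using alpha_sym[of "(=)" F G] by (simp add: eq_commute)

lemma alpha_eq_trans: "alpha \<rho> F G \<Longrightarrow> alpha (=) G H \<Longrightarrow> alpha \<rho> F H"
  by (rule alpha_mono[OF alpha_trans]) auto

lemma alpha_free: "alpha \<rho> F G \<Longrightarrow> a \<in> free F \<Longrightarrow> \<exists>b\<in>free G. \<rho> a b"
proof (induction F arbitrary: \<rho> G)
  case (Atom r xs)
  then show ?case
    by (fastforce simp: list_all2_conv_all_nth in_set_conv_nth)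
next
  case (Quant q x A)
  then obtain y B where "G = Quant q y B" "alpha (bind_rel \<rho> x y) A B"
    by auto
  moreover from this obtain b where "b \<in> free B" "bind_rel \<rho> x y a b"
    using Quant by auto
  ultimately show ?case
    using Quant.prems by (auto simp: bind_rel_def)
qed fastforce+

lemma alpha_free': "alpha \<rho> F G \<Longrightarrow> b \<in> free G \<Longrightarrow> \<exists>a\<in>free F. \<rho> a b"
  using alpha_free[OF alpha_sym] by fastforce

lemma alpha_card_free:
  assumes "alpha \<rho> F G" "bi_unique \<rho>"
  shows "card (free F) = card (free G)"
proof -
  have "rel_set \<rho> (free F) (free G)"
    using alpha_free[OF assms(1)] alpha_free'[OF assms(1)] by (auto simp: rel_set_def)
  with assms(2) show ?thesis
    using card_transfer by (auto simp: rel_fun_def)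
qed

lemma bi_unique_bind_rel: "bi_unique \<rho> \<Longrightarrow> bi_unique (bind_rel \<rho> x y)"
  by (auto simp: bi_unique_def bind_rel_def)

text \<open>A bi-unique correspondence matches the free variables of corresponding subformulas one
  to one, and it stays bi-unique under binders.\<close>

lemma alpha_width: "alpha \<rho> F G \<Longrightarrow> bi_unique \<rho> \<Longrightarrow> width F = width G"
proof (induction F arbitrary: \<rho> G)
  case (Atom r xs)
  then show ?case
    using alpha_card_free[OF Atom] by auto
next
  case (Bin c A B)
  then show ?case
    using alpha_card_free[OF Bin.prems] by fastforce
next
  case (Quant q x A)
  then show ?case
    using bi_unique_bind_rel by fastforce
qed fastforce+

lemma rename_idle: "x \<notin> free F \<Longrightarrow> rename x y F = F"
  by (induction F) (auto intro: map_idI)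

lemma alpha_rename:
  "substitutable x y F \<Longrightarrow> (\<And>a. a \<in> free F \<Longrightarrow> \<rho> a (if a = x then y else a)) \<Longrightarrow>
    alpha \<rho> F (rename x y F)"
proof (induction F arbitrary: \<rho>)
  case (Atom r xs)
  then show ?case
    by (auto simp: list_all2_conv_all_nth)
next
  case (Quant q z A)
  show ?case
  proof (cases "x \<in> free (Quant q z A)")
    case True
    then have sub: "substitutable x y A" "x \<noteq> z" "z \<noteq> y"
      using Quant.prems(1) by auto
    have "bind_rel \<rho> z z a (if a = x then y else a)" if "a \<in> free A" for a
      using that sub Quant.prems(2)[of a] by (auto simp: bind_rel_def)
    with sub have "alpha (bind_rel \<rho> z z) A (rename x y A)"
      by (intro Quant.IH)
    then show ?thesis
      using True by auto
  next
    case False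
    then have "alpha \<rho> (Quant q z A) (Quant q z A)"
      by (intro alpha_refl) (use Quant.prems in \<open>metis\<close>)
    moreover have "rename x y (Quant q z A) = Quant q z A"
      using False by (rule rename_idle)
    ultimately show ?thesis
      by simp
  qed
qed auto

lemma substitutableI: "y \<notin> bound F \<Longrightarrow> substitutable x y F"
  by (induction F) auto

lemma bound_rename [simp]: "bound (rename x y F) = bound F"
  by (induction F) auto

lemma size_rename [simp]: "size (rename x y F) = size F"
  by (induction F) auto

lemma free_rename: "free (rename x y F) \<subseteq> insert y (free F - {x})"
  by (induction F) auto

lemma well_named_rename:
  "well_named F \<Longrightarrow> y \<notin> bound F \<Longrightarrow> well_named (rename x y F)"
  by (induction F) (use free_rename in \<open>fastforce\<close>)+

lemma alpha_bind_rename: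
  assumes "substitutable x y F" "y \<notin> free F"
  shows "alpha (bind_rel (=) x y) F (rename x y F)"
  using assms by (intro alpha_rename) (auto simp: bind_rel_def)

lemma alpha_Quant_rename:
  assumes "substitutable x y F" "y \<notin> free F"
  shows "alpha (=) (Quant q x F) (Quant q y (rename x y F))"
  using alpha_bind_rename[OF assms] by simp

lemma alpha_eq_Quant: "alpha (=) A B \<Longrightarrow> alpha (=) (Quant q x A) (Quant q x B)"
  using alpha_mono[of "(=)" A B "bind_rel (=) x x"] by (auto simp: bind_rel_def)

lemma finite_avoid: "finite (A :: var set) \<Longrightarrow> \<exists>z. z \<notin> A"
  by (simp add: ex_new_if_finite)

text \<open>The set \<open>S\<close> of forbidden names makes the induction work: in the binary case
  the binders of the second child are chosen to avoid the names already used in the first.\<close>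

lemma well_named_exists:
  "finite S \<Longrightarrow> \<exists>G. alpha (=) F G \<and> well_named G \<and> bound G \<inter> S = {}"
proof (induction F arbitrary: S)
  case (Atom r xs)
  have "alpha (=) (Atom r xs) (Atom r xs)"
    by (rule alpha_refl) simp
  then show ?case
    by (metis bound.simps(1) inf_bot_left well_named.simps(1))
next
  case (Neg A)
  then show ?case by fastforce
next
  case (Bin c A B)
  from Bin.IH(1)[of "S \<union> free B"] Bin.prems obtain A'
    where A': "alpha (=) A A'" "well_named A'" "bound A' \<inter> (S \<union> free B) = {}"
    by auto
  from Bin.IH(2)[of "S \<union> free A \<union> bound A'"] Bin.prems obtain B'
    where B': "alpha (=) B B'" "well_named B'" "bound B' \<inter> (S \<union> free A \<union> bound A') = {}"
    by auto
  have "free A' = free A" "free B' = free B"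
    using A'(1) B'(1) alpha_free alpha_free' by blast+
  with A' B' show ?case
    by (intro exI[of _ "Bin c A' B'"]) auto
next
  case (Quant q x A)
  from Quant.IH[OF Quant.prems] obtain A'
    where A': "alpha (=) A A'" "well_named A'" "bound A' \<inter> S = {}"
    by auto
  obtain z where z: "z \<notin> S \<union> bound A' \<union> free A'"
    using finite_avoid[of "S \<union> bound A' \<union> free A'"] Quant.prems by auto
  have "alpha (=) (Quant q x A) (Quant q x A')"
    using A'(1) by (rule alpha_eq_Quant)
  moreover have "alpha (=) (Quant q x A') (Quant q z (rename x z A'))"
    using z by (intro alpha_Quant_rename substitutableI) auto
  ultimately have "alpha (=) (Quant q x A) (Quant q z (rename x z A'))"
    by (rule alpha_eq_trans)
  moreover have "well_named (Quant q z (rename x z A'))"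
    using A' z by (auto intro: well_named_rename)
  ultimately show ?case
    using A' z by (intro exI[of _ "Quant q z (rename x z A')"]) auto
qed

section \<open>Simulation of derivations up to renaming\<close>

lemma rewr_root_push:
  assumes "rewr_root Rule_Pdown F G"
  shows "acop F G"
  using assms
proof (cases rule: rewr_root.cases)
  case (push_Ex x F2 F1)
  then show ?thesis
    using acop.push[of x F2 Ex F1] by simp
next
  case (push_All x F2 F1)
  then show ?thesis
    using acop.push[of x F2 All F1] by simp
qed

text \<open>Renaming is the one rule outside \<open>acop\<close>, and it stays within an
  alpha-class; both alternatives pass through contexts.\<close>

lemma rewr_T_acop_or_alpha: "rewr T_rules F G \<Longrightarrow> acop F G \<or> alpha (=) F G"
proof (induction rule: rewr.induct)
  case (root R F G)
  from root(2) show ?case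
  proof (cases rule: rewr_root.cases)
    case (rename y A x q)
    then show ?thesis
      using alpha_Quant_rename by blast
  qed (use root in \<open>auto simp: T_rules_def intro: acop.intros rewr_root_push acop_sym\<close>)
next
  case (left F G c H)
  then show ?case
    by (auto intro: acop.intros alpha_refl)
next
  case (right F G c H)
  then show ?case
    by (auto intro: acop.intros alpha_refl)
next
  case (quant F G q x)
  then show ?case
    using acop.quant alpha_eq_Quant by blast
qed (auto intro: acop.intros)

lemma acop_rewr: "acop F G \<Longrightarrow> rewr T_rules F G"
proof (induction rule: acop.induct)
  case (push x B q A)
  then show ?case
    by (cases q) (auto simp: T_rules_def intro!: rewr.root[of Rule_Pdown] rewr_root.intros)
next
  case (pull x B q A)
  then show ?case
    by (cases q) (auto simp: T_rules_def intro!: rewr.root[of Rule_Pup] rewr_root.intros)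
qed (auto simp: T_rules_def intro: rewr.intros rewr_root.intros)

text \<open>The step is repeated with the binders of \<open>F\<close>. Well-namedness of
  \<open>F\<close> provides what concerns these names: \<open>pull\<close> needs its binder fresh
  for \<open>B'\<close>, and two binders can be swapped consistently only if they differ.\<close>

lemma alpha_acop:
  "acop G G' \<Longrightarrow> alpha \<rho> G F \<Longrightarrow> well_named F \<Longrightarrow> \<exists>F'. F \<approx> F' \<and> alpha \<rho> G' F'"
proof (induction arbitrary: \<rho> F rule: acop.induct)
  case (assocl c A B C)
  then obtain A' B' C' where "F = Bin c A' (Bin c B' C')"
    "alpha \<rho> A A'" "alpha \<rho> B B'" "alpha \<rho> C C'"
    by auto
  then show ?case
    using acop_intros(1)[of c A' B' C'] by auto
next
  case (assocr c A B C)
  then obtain A' B' C' where "F = Bin c (Bin c A' B') C'"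
    "alpha \<rho> A A'" "alpha \<rho> B B'" "alpha \<rho> C C'"
    by auto
  then show ?case
    using acop_intros(2)[of c A' B' C'] by auto
next
  case (comm c A B)
  then obtain A' B' where "F = Bin c A' B'" "alpha \<rho> A A'" "alpha \<rho> B B'"
    by auto
  then show ?case
    using acop_intros(3)[of c A' B'] by auto
next
  case (swap q x y A)
  then obtain u v A' where F: "F = Quant q u (Quant q v A')"
    "alpha (bind_rel (bind_rel \<rho> x u) y v) A A'"
    by auto
  show ?case
  proof (cases "x = y")
    case True
    then show ?thesis
      using swap.prems by blast
  next
    case False
    have "u \<noteq> v"
      using F swap.prems by auto
    with False have "alpha (bind_rel (bind_rel \<rho> y v) x u) A A'"
      by (intro alpha_mono[OF F(2)]) (auto simp: bind_rel_def)
    then have "alpha \<rho> (Quant q y (Quant q x A)) (Quant q v (Quant q u A'))"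
      by auto
    then show ?thesis
      unfolding F(1) using acop_intros(4) by blast
  qed
next
  case (push x B q A)
  then obtain u A' B' where F: "F = Quant q u (Bin (conn_of q) A' B')"
    "alpha (bind_rel \<rho> x u) A A'" "alpha (bind_rel \<rho> x u) B B'"
    by auto
  have u: "u \<notin> free B'"
    using alpha_free'[OF F(3)] push.hyps by (auto simp: bind_rel_def)
  have "alpha \<rho> B B'"
    by (rule alpha_mono[OF F(3)]) (use u push.hyps in \<open>auto simp: bind_rel_def\<close>)
  with F have "alpha \<rho> (Bin (conn_of q) (Quant q x A) B) (Bin (conn_of q) (Quant q u A') B')"
    by auto
  with u show ?case
    unfolding F(1) using acop_intros(5) by blast
next
  case (pull x B q A)
  then obtain u A' B' where F: "F = Bin (conn_of q) (Quant q u A') B'"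
    "alpha (bind_rel \<rho> x u) A A'" "alpha \<rho> B B'"
    by auto
  have u: "u \<notin> free B'"
    using F(1) pull.prems by auto
  have "alpha (bind_rel \<rho> x u) B B'"
    by (rule alpha_mono[OF F(3)]) (use u pull.hyps in \<open>auto simp: bind_rel_def\<close>)
  with F have "alpha \<rho> (Quant q x (Bin (conn_of q) A B)) (Quant q u (Bin (conn_of q) A' B'))"
    by auto
  with u show ?case
    unfolding F(1) using acop_intros(6) by blast
next
  case (neg A B)
  then obtain A' where "F = Neg A'" "alpha \<rho> A A'" "well_named A'"
    by auto
  with neg.IH obtain B' where "A' \<approx> B'" "alpha \<rho> B B'"
    by blast
  then show ?case
    using \<open>F = Neg A'\<close> acop_eq_Neg by auto
next
  case (left A B c C)
  then obtain A' C' where F: "F = Bin c A' C'" "alpha \<rho> A A'" "alpha \<rho> C C'" "well_named A'"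
    by auto
  with left.IH obtain B' where "A' \<approx> B'" "alpha \<rho> B B'"
    by blast
  then show ?case
    using F acop_eq_left by (intro exI[of _ "Bin c B' C'"]) auto
next
  case (right A B c C)
  then obtain A' C' where F: "F = Bin c C' A'" "alpha \<rho> A A'" "alpha \<rho> C C'" "well_named A'"
    by auto
  with right.IH obtain B' where "A' \<approx> B'" "alpha \<rho> B B'"
    by blast
  then show ?case
    using F acop_eq_right by (intro exI[of _ "Bin c C' B'"]) auto
next
  case (quant A B q x)
  then obtain u A' where F: "F = Quant q u A'" "alpha (bind_rel \<rho> x u) A A'" "well_named A'"
    by auto
  with quant.IH obtain B' where "A' \<approx> B'" "alpha (bind_rel \<rho> x u) B B'"
    by blast
  then show ?case
    using F acop_eq_Quant by (intro exI[of _ "Quant q u B'"]) auto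
qed

text \<open>A well-named companion accompanies the derivation: a renaming step leaves it unchanged,
  any other step is repeated on it. Thus only \<open>\<approx>\<close> remains.\<close>

lemma alpha_equivclp:
  assumes "equivclp (rewr T_rules) F G" "alpha (=) F F0" "well_named F0"
  shows "\<exists>G0. F0 \<approx> G0 \<and> alpha (=) G G0"
  using assms(1)
proof (induction rule: equivclp_induct)
  case base
  then show ?case
    using assms by blast
next
  case (step G H)
  then obtain G0 where G0: "F0 \<approx> G0" "alpha (=) G G0"
    by blast
  from step(2) have "acop G H \<or> alpha (=) G H"
    by (auto dest!: rewr_T_acop_or_alpha intro: acop_sym alpha_eq_sym)
  then show ?case
  proof
    assume "acop G H"
    with G0 assms(3) obtain H0 where "G0 \<approx> H0" "alpha (=) H H0"
      using alpha_acop acop_eq_well_named by blast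
    with G0 show ?thesis
      by (meson rtranclp_trans)
  next
    assume "alpha (=) G H"
    then have "alpha (=) H G0"
      using G0 alpha_eq_sym alpha_eq_trans by blast
    with G0 show ?thesis by blast
  qed
qed

text \<open>These two rules move no binder across a formula outside its scope, so the step is
  available under the binder names of \<open>F\<close>; vacuity for \<open>Rule_M\<close> transfers
  along the correspondence.\<close>

lemma alpha_rewr_reducing:
  "rewr {Rule_Sdown, Rule_M} G G' \<Longrightarrow> alpha \<rho> G F \<Longrightarrow>
    \<exists>F'. rewr {Rule_Sdown, Rule_M} F F' \<and> alpha \<rho> G' F'"
proof (induction arbitrary: \<rho> F rule: rewr.induct)
  case (root R G G')
  have R: "R = Rule_Sdown \<or> R = Rule_M"
    using root(1) by auto
  from root(2) show ?case
  proof (cases rule: rewr_root.cases)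
    case (split_Ex x A B)
    with root obtain u A' B' where F: "F = Quant Ex u (Bin Or A' B')"
      "alpha (bind_rel \<rho> x u) A A'" "alpha (bind_rel \<rho> x u) B B'"
      by auto
    then have "alpha \<rho> G' (Bin Or (Quant Ex u A') (Quant Ex u B'))"
      using split_Ex by auto
    then show ?thesis
      unfolding F(1) by (blast intro: rewr.root[of Rule_Sdown] rewr_root.split_Ex)
  next
    case (split_All x A B)
    with root obtain u A' B' where F: "F = Quant All u (Bin And A' B')"
      "alpha (bind_rel \<rho> x u) A A'" "alpha (bind_rel \<rho> x u) B B'"
      by auto
    then have "alpha \<rho> G' (Bin And (Quant All u A') (Quant All u B'))"
      using split_All by auto
    then show ?thesis
      unfolding F(1) by (blast intro: rewr.root[of Rule_Sdown] rewr_root.split_All)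
  next
    case (remove x q)
    with root obtain u A' where F: "F = Quant q u A'" "alpha (bind_rel \<rho> x u) G' A'"
      by auto
    have u: "u \<notin> free A'"
      using alpha_free'[OF F(2)] remove by (auto simp: bind_rel_def)
    have "alpha \<rho> G' A'"
      by (rule alpha_mono[OF F(2)]) (use u remove in \<open>auto simp: bind_rel_def\<close>)
    with u show ?thesis
      unfolding F(1) by (blast intro: rewr.root[of Rule_M] rewr_root.remove)
  qed (use R in auto)
next
  case (neg A B)
  then obtain A' where F: "F = Neg A'" "alpha \<rho> A A'"
    by auto
  with neg.IH show ?case
    using rewr.neg by fastforce
next
  case (left A B c C)
  then obtain A' C' where F: "F = Bin c A' C'" "alpha \<rho> A A'" "alpha \<rho> C C'"
    by auto
  with left.IH show ?case
    using rewr.left by fastforce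
next
  case (right A B c C)
  then obtain A' C' where F: "F = Bin c C' A'" "alpha \<rho> A A'" "alpha \<rho> C C'"
    by auto
  with right.IH show ?case
    using rewr.right by fastforce
next
  case (quant A B q x)
  then obtain u A' where F: "F = Quant q u A'" "alpha (bind_rel \<rho> x u) A A'"
    by auto
  with quant.IH show ?case
    using rewr.quant by fastforce
qed

lemma equivclp_rewr_cong:
  assumes "equivclp (rewr Rs) F G" "\<And>A B. rewr Rs A B \<Longrightarrow> rewr Rs (f A) (f B)"
  shows "equivclp (rewr Rs) (f F) (f G)"
  using assms(1)
proof (induction rule: equivclp_induct)
  case (step G H)
  from step(2) have "equivclp (rewr Rs) (f G) (f H)"
    using assms(2) r_into_equivclp converse_r_into_equivclp by metis
  with step.IH show ?case
    by (rule equivclp_trans)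
qed simp

lemma rewr_T_rename:
  assumes "y \<notin> free A" "y \<notin> bound A"
  shows "equivclp (rewr T_rules) (Quant q x A) (Quant q y (rename x y A))"
  by (intro r_into_equivclp rewr.root[of Rule_N] rewr_root.rename substitutableI)
    (use assms in \<open>auto simp: T_rules_def\<close>)

lemma alpha_imp_equivclp: "alpha (=) F G \<Longrightarrow> equivclp (rewr T_rules) F G"
proof (induction "size F" arbitrary: F G rule: less_induct)
  case less
  show ?case
  proof (cases F)
    case (Atom r xs)
    with less.prems show ?thesis
      by (simp add: list.rel_eq)
  next
    case (Neg A)
    with less obtain B where "G = Neg B" "equivclp (rewr T_rules) A B"
      by auto
    then show ?thesis
      unfolding Neg using equivclp_rewr_cong[where f = Neg] rewr.neg by blast
  next
    case (Bin c A B)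
    with less obtain A' B' where G: "G = Bin c A' B'" "equivclp (rewr T_rules) A A'"
      "equivclp (rewr T_rules) B B'"
      by auto
    have "equivclp (rewr T_rules) (Bin c A B) (Bin c A' B)"
      using equivclp_rewr_cong[OF G(2), where f = "\<lambda>F. Bin c F B"] rewr.left by blast
    moreover have "equivclp (rewr T_rules) (Bin c A' B) (Bin c A' B')"
      using equivclp_rewr_cong[OF G(3), where f = "Bin c A'"] rewr.right by blast
    ultimately show ?thesis
      unfolding Bin G(1) by (rule equivclp_trans)
  next
    case (Quant q x A)
    with less.prems obtain y B where G: "G = Quant q y B" "alpha (bind_rel (=) x y) A B"
      by auto
    \<comment> \<open>Renaming \<open>x\<close> to \<open>y\<close> directly could be blocked by
      inner binders of \<open>y\<close>, so both sides are renamed to a common fresh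
      \<open>z\<close>.\<close>
    obtain z where z: "z \<notin> free A \<union> bound A \<union> free B \<union> bound B"
      using finite_avoid[of "free A \<union> bound A \<union> free B \<union> bound B"] by auto
    have A: "alpha (bind_rel (=) x z) A (rename x z A)"
      using z by (intro alpha_bind_rename substitutableI) auto
    have B: "alpha (bind_rel (=) y z) B (rename y z B)"
      using z by (intro alpha_bind_rename substitutableI) auto
    \<comment> \<open>The three correspondences lead from \<open>z\<close> to \<open>x\<close>,
      \<open>y\<close> and back to \<open>z\<close>, and relate any other variable only to itself,
      so their composition lies inside equality.\<close>
    have "alpha (=) (rename x z A) (rename y z B)"
      by (rule alpha_mono[OF alpha_trans[OF alpha_trans[OF alpha_sym[OF A] G(2)] B]])
        (auto simp: bind_rel_def)
    then have "equivclp (rewr T_rules) (rename x z A) (rename y z B)"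
      using less.hyps Quant by simp
    then have "equivclp (rewr T_rules) (Quant q z (rename x z A)) (Quant q z (rename y z B))"
      by (rule equivclp_rewr_cong) (rule rewr.quant)
    moreover have "equivclp (rewr T_rules) F (Quant q z (rename x z A))"
      unfolding Quant using z by (intro rewr_T_rename) auto
    moreover have "equivclp (rewr T_rules) (Quant q z (rename y z B)) G"
      unfolding G(1) using z by (intro equivclp_sym[OF rewr_T_rename]) auto
    ultimately show ?thesis
      by (meson equivclp_trans)
  qed
qed

lemma acop_eq_equivclp: "F \<approx> G \<Longrightarrow> equivclp (rewr T_rules) F G"
  by (induction rule: rtranclp_induct)
    (auto intro: acop_rewr r_into_equivclp equivclp_trans)

section \<open>Pfo-formulas and the comparison of the infima\<close>

lemma PFO_simps [simp]:
  "Atom r xs \<in> PFO ar \<longleftrightarrow> length xs = ar r"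
  "Neg A \<notin> PFO ar"
  "Bin c A B \<in> PFO ar \<longleftrightarrow> A \<in> PFO ar \<and> B \<in> PFO ar"
  "Quant q x A \<in> PFO ar \<longleftrightarrow> A \<in> PFO ar"
  by (auto simp: PFO_def)

lemma rename_PFO [simp]: "rename x y A \<in> PFO ar \<longleftrightarrow> A \<in> PFO ar"
  by (induction A) auto

lemma rewr_root_PFO: "rewr_root R F G \<Longrightarrow> F \<in> PFO ar \<longleftrightarrow> G \<in> PFO ar"
  by (induction rule: rewr_root.induct) auto

lemma rewr_PFO: "rewr Rs F G \<Longrightarrow> F \<in> PFO ar \<longleftrightarrow> G \<in> PFO ar"
  by (induction rule: rewr.induct) (auto simp: rewr_root_PFO)

text \<open>Rewriting never leaves the pfo-formulas, so a derivation constructed for arbitrary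
  formulas stays inside \<open>PFO_equiv\<close>.\<close>

lemma equivclp_PFO: "equivclp (rewr Rs) F G \<Longrightarrow> F \<in> PFO ar \<Longrightarrow> G \<in> PFO ar"
  by (induction rule: equivclp_induct) (auto dest: rewr_PFO)

text \<open>The simulations in sequence: \<open>\<phi>\<close> gets the well-named variant
  \<open>\<phi>0\<close>; the derivation to \<open>\<theta>1\<close> becomes
  \<open>\<phi>0 \<approx> \<theta>0\<close>, and the step is copied to \<open>\<theta>0\<close>.
  Carried back along \<open>\<approx>\<close>, it becomes a reduction of \<open>\<phi>0\<close>
  itself, where \<open>reduce_width\<close> controls the width.\<close>

lemma reducing_width:
  assumes step: "rewr {Rule_Sdown, Rule_M} \<theta>1 \<theta>2" and eq: "equivclp (rewr T_rules) \<phi> \<theta>1"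
  shows "\<exists>\<psi>. equivclp (rewr T_rules) \<theta>2 \<psi> \<and> width \<psi> \<le> width \<phi>"
proof -
  obtain \<phi>0 where \<phi>0: "alpha (=) \<phi> \<phi>0" "well_named \<phi>0"
    using well_named_exists[of "{}" \<phi>] by auto
  obtain \<theta>0 where \<theta>0: "\<phi>0 \<approx> \<theta>0" "alpha (=) \<theta>1 \<theta>0"
    using alpha_equivclp[OF eq \<phi>0] by blast
  obtain \<theta>0' where \<theta>0': "rewr {Rule_Sdown, Rule_M} \<theta>0 \<theta>0'" "alpha (=) \<theta>2 \<theta>0'"
    using alpha_rewr_reducing[OF step \<theta>0(2)] by blast
  obtain \<chi> where \<chi>: "reduce \<phi>0 \<chi>" "\<chi> \<approx> \<theta>0'"
    using reduce_acop_eq[OF \<theta>0(1) \<phi>0(2) rewr_reduce[OF \<theta>0'(1)]] by blast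
  obtain \<psi> where \<psi>: "\<psi> \<approx> \<chi>" "width \<psi> \<le> width \<phi>0"
    using reduce_width[OF \<chi>(1) \<phi>0(2)] by blast
  have "equivclp (rewr T_rules) \<psi> \<theta>0'"
    using \<psi>(1) \<chi>(2) by (intro acop_eq_equivclp) (rule rtranclp_trans)
  then have "equivclp (rewr T_rules) \<theta>2 \<psi>"
    using alpha_imp_equivclp[OF \<theta>0'(2)] equivclp_sym equivclp_trans by metis
  moreover have "width \<phi>0 = width \<phi>"
    using alpha_width[OF \<phi>0(1)] by (simp add: bi_unique_eq)
  ultimately show ?thesis
    using \<psi>(2) by auto
qed

theorem theorem4p5:
  fixes ar :: "'r \<Rightarrow> nat"
  shows "gauged_monotone
    (gauged_quotient (PFO_width_system ar {Rule_Sdown, Rule_M}) (PFO_equiv ar T_rules))"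
proof -
  let ?E = "PFO_equiv ar T_rules"
  have "(INF \<phi>\<in>C2. real (width \<phi>)) \<le> (INF \<phi>\<in>C1. real (width \<phi>))"
    if C1: "C1 \<in> PFO ar // ?E" and C2: "C2 \<in> PFO ar // ?E"
      and \<theta>1: "\<theta>1 \<in> C1" and \<theta>2: "\<theta>2 \<in> C2"
      and step: "(\<theta>1, \<theta>2) \<in> PFO_rewr ar {Rule_Sdown, Rule_M}" for C1 C2 \<theta>1 \<theta>2
  proof (rule cINF_mono)
    show "C1 \<noteq> {}"
      using \<theta>1 by auto
    show "bdd_below ((\<lambda>\<phi>. real (width \<phi>)) ` C2)"
      by (rule bdd_belowI[of _ 0]) auto
    \<comment> \<open>Any \<open>\<phi>\<close> in \<open>C1\<close> is equivalent to
      \<open>\<theta>1\<close>, so \<open>reducing_width\<close> yields a member of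
      \<open>C2\<close> that is no wider; this gives the inequality of the infima.\<close>
    fix \<phi>
    assume "\<phi> \<in> C1"
    with C1 \<theta>1 have "(\<phi>, \<theta>1) \<in> ?E"
      using quotient_eq_iff[OF equiv_PFO_equiv C1 C1] by blast
    then have "equivclp (rewr T_rules) \<phi> \<theta>1"
      by (simp add: PFO_equiv_def)
    moreover have "rewr {Rule_Sdown, Rule_M} \<theta>1 \<theta>2"
      using step by (simp add: PFO_rewr_def)
    ultimately obtain \<psi> where \<psi>: "equivclp (rewr T_rules) \<theta>2 \<psi>" "width \<psi> \<le> width \<phi>"
      using reducing_width by blast
    moreover have "\<theta>2 \<in> PFO ar"
      using step by (simp add: PFO_rewr_def)
    ultimately have "(\<theta>2, \<psi>) \<in> ?E"
      using equivclp_PFO by (auto simp: PFO_equiv_def)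
    then have "\<psi> \<in> C2"
      using in_quotient_imp_closed[OF equiv_PFO_equiv C2 \<theta>2] by blast
    with \<psi> show "\<exists>\<psi>\<in>C2. real (width \<psi>) \<le> real (width \<phi>)"
      by auto
  qed
  then show ?thesis
    by (auto simp: gauged_monotone_def gauged_quotient_def PFO_width_system_def)
qed

end
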